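(* Let $V$ be a finite-dimensional Euclidean Jordan algebra (over $\mathbb{R}$, with identity $e$) of rank $d$, with cone of squares $\mathcal{Q}$. Let $h : \mathbb{R}_{>} \to \mathbb{R}$ be a convex $C^3$-smooth function, let $\varphi : \operatorname{int}(\mathcal{Q}) \to \mathbb{R}$ be the separable spectral function $\varphi(w) = \operatorname{tr}(h(w)) = \sum_{i=1}^d h(w_i)$, assumed non-homogeneous, and let $$\Gamma(u,v,w) = -\log\bigl(u - v\varphi(v^{-1}w)\bigr) - \log(v) - \log(\det(w)),$$ defined on the set of $(u,v,w) \in \mathbb{R}\times\mathbb{R}_{>}\times \operatorname{int}(\mathcal{Q})$ with $u - v\varphi(v^{-1}w) > 0$. Let $\tilde u = (u,v,w)$ be a point of this set such that $w = \sum_{i=1}^d w_i c_i$ has distinct eigenvalues $w_1,\dots,w_d > 0$ with Jordan frame $c_1,\dots,c_d$, and let $\tilde p = (p,q,r) \in \mathbb{R}\times\mathbb{R}\times V$. Put $\mu = v^{-1} w$, $\zeta = u - v \varphi(\mu)$, let $h'_i = h'(v^{-1}w_i)$, $h''_i = h''(v^{-1}w_i)$, $\nabla\varphi = \nabla\varphi(\mu) = \sum_i h'_i c_i$, $\sigma = \varphi(\mu) - \langle \nabla\varphi, \mu\rangle$, and $$m_{i,j} = \zeta^{-1}\frac{h'_i - h'_j}{w_i - w_j} + w_i^{-1} w_j^{-1} \ (i \neq j), \qquad m_{i,i} = \zeta^{-1} v^{-1} h''_i + w_i^{-2},$$ $$M^{-1} = \sum_{1\le i<j\le d} 4 m_{i,j}^{-1}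 L(c_i) L(c_j) + \sum_{i=1}^d m_{i,i}^{-1} P(c_i),$$ $$\alpha = \sum_{i=1}^d m_{i,i}^{-1} h'_i c_i, \qquad \gamma = v^{-2}\zeta^{-1} \sum_{i=1}^d m_{i,i}^{-1} h''_i w_i c_i,$$ $$k_1 = \zeta^2 + \langle \nabla\varphi, \alpha\rangle, \qquad k_2 = \sigma + \langle \nabla\varphi, \gamma\rangle, \qquad k_3 = v^{-2} + v^{-1}\langle \gamma, w^{-1}\rangle .$$ Then the inverse Hessian product $(\bar H_u, \bar H_v, \bar H_w) = (\nabla^2\Gamma(\tilde u))^{-1}[\tilde p]$ is $$\bar H_v = k_3^{-1}\bigl(k_2 p + q + \langle \gamma, r\rangle\bigr), \qquad \bar H_u = k_1 p + k_2 \bar H_v + \langle \alpha, r\rangle, \qquad \bar H_w = p\,\alpha + \bar H_v\,\gamma + M^{-1} r .$$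
   Context: $\mathbb{R}_{>} = (0,\infty)$; $\operatorname{int}$ denotes interior. Jordan algebra conventions: the product is $\circ$; a Jordan algebra is Euclidean if $\langle w_a \circ w_b, w_c\rangle = \langle w_b, w_a \circ w_c\rangle$ for an inner product. The rank $d$ of $V$ is the number of elements in any Jordan frame (complete system of pairwise orthogonal primitive idempotents, summing to $e$). Every $w \in V$ has a spectral decomposition $w = \sum_{i=1}^d w_i c_i$ with real eigenvalues $w_i$ and a Jordan frame $c_1,\dots,c_d$. One sets $\operatorname{tr}(w) = \sum_i w_i$ and $\det(w) = \prod_i w_i$. The inner product on $V$ is $\langle w_a, w_b \rangle = \operatorname{tr}(w_a \circ w_b)$, and $\mathbb{R}\times\mathbb{R}\times V$ carries the product inner product. The cone of squares is $\mathcal{Q} = \{ w \circ w : w \in V\}$; $w \in \operatorname{int}(\mathcal{Q})$ iff all $w_i > 0$, and then $h(w) = \sum_i h(w_i) c_i$ and $w^{-1} = \sum_i w_i^{-1} c_i$. Homogeneous means positively homogeneous of degree one. $L(w) : V \to V$ is $L(w) x = w \circ x$, and the quadratic representation is $P(w) = 2 L(w)^2 - L(w \circ w)$. The Hessian $\nabla^2 \Gamma(\tilde u)$ is viewed as the self-adjoint linear operator on $\mathbb{R} \times\mathbb{R}\times V$ with $\langle \nabla^2\Gamma(\tilde u)[\tilde p], \tilde p'\rangle$ equal to the second directional derivative of $\Gamma$ at $\tilde u$ in directions $\tilde p, \tilde p'$; it is positive definite, and $(\nabla^2 \Gamma(\tilde u))^{-1}$ is its inverse operator. *)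

theory Defs
  imports "HOL-Analysis.Analysis"
begin

class jordan_algebra = real_vector +
  fixes jprod :: "'a \<Rightarrow> 'a \<Rightarrow> 'a"  (infixl "\<odot>" 70)
    and junit :: "'a"
  assumes jprod_commute: "x \<odot> y = y \<odot> x"
    and jprod_add_left: "(x + y) \<odot> z = x \<odot> z + y \<odot> z"
    and jprod_scaleR_left: "(a *\<^sub>R x) \<odot> y = a *\<^sub>R (x \<odot> y)"
    and jordan_identity: "x \<odot> ((x \<odot> x) \<odot> y) = (x \<odot> x) \<odot> (x \<odot> y)"
    and junit_left: "junit \<odot> x = x"
begin

definition jL :: "'a \<Rightarrow> 'a \<Rightarrow> 'a" where
  "jL w x = w \<odot> x"

definition jP :: "'a \<Rightarrow> 'a \<Rightarrow> 'a" where
  "jP w x = 2 *\<^sub>R jL w (jL w x) - jL (w \<odot> w) x"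

definition idempotent :: "'a \<Rightarrow> bool" where
  "idempotent c \<longleftrightarrow> c \<odot> c = c"

definition primitive_idempotent :: "'a \<Rightarrow> bool" where
  "primitive_idempotent c \<longleftrightarrow> idempotent c \<and> c \<noteq> 0 \<and>
     \<not> (\<exists>a b. idempotent a \<and> idempotent b \<and> a \<noteq> 0 \<and> b \<noteq> 0 \<and> a \<odot> b = 0 \<and> c = a + b)"

text \<open>Frames are indexed by \<open>{1..n}\<close>; the values of \<open>c\<close> at other indices are irrelevant.\<close>

definition jordan_frame :: "nat \<Rightarrow> (nat \<Rightarrow> 'a) \<Rightarrow> bool" where
  "jordan_frame n c \<longleftrightarrow>
     (\<forall>i\<in>{1..n}. primitive_idempotent (c i)) \<and>
     (\<forall>i\<in>{1..n}. \<forall>j\<in>{1..n}. i \<noteq> j \<longrightarrow> c i \<odot> c j = 0) \<and>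
     (\<Sum>i=1..n. c i) = junit"

definition jrank :: "'a itself \<Rightarrow> nat" where
  "jrank _ = (THE n. \<exists>c. jordan_frame n c)"

definition spectral_decomp :: "nat \<Rightarrow> 'a \<Rightarrow> (nat \<Rightarrow> real) \<Rightarrow> (nat \<Rightarrow> 'a) \<Rightarrow> bool" where
  "spectral_decomp n w ev c \<longleftrightarrow> jordan_frame n c \<and> w = (\<Sum>i=1..n. ev i *\<^sub>R c i)"

text \<open>
  In a Euclidean Jordan algebra every element has a spectral decomposition, and the following
  values do not depend on its choice.
\<close>

definition jtrace :: "'a \<Rightarrow> real" where
  "jtrace w = (THE t. \<exists>n ev c. spectral_decomp n w ev c \<and> t = (\<Sum>i=1..n. ev i))"

definition jdet :: "'a \<Rightarrow> real" where
  "jdet w = (THE t. \<exists>n ev c. spectral_decomp n w ev c \<and> t = (\<Prod>i=1..n. ev i))"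

definition jfun :: "(real \<Rightarrow> real) \<Rightarrow> 'a \<Rightarrow> 'a" where
  "jfun f w = (THE z. \<exists>n ev c. spectral_decomp n w ev c \<and> z = (\<Sum>i=1..n. f (ev i) *\<^sub>R c i))"

definition jinv :: "'a \<Rightarrow> 'a" where
  "jinv = jfun inverse"

definition cone_of_squares :: "'a set" where
  "cone_of_squares = {w \<odot> w |w. True}"

end

text \<open>
  The inner product of the carrier type is normalised to be the trace form, so the inner product
  that the library puts on \<open>real \<times> real \<times> 'a\<close> is the product inner product
  built from it.
\<close>

class euclidean_jordan_algebra = euclidean_space + jordan_algebra +
  assumes inner_jprod: "inner (x \<odot> y) z = inner y (x \<odot> z)"
    and inner_eq_jtrace: "inner x y = jtrace (x \<odot> y)"

text \<open>The derivatives are those of a function on all reals, but for an open set \<open>S\<close> their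
  values on \<open>S\<close> depend only on the restriction to \<open>S\<close>.\<close>

definition Ck_on :: "nat \<Rightarrow> (real \<Rightarrow> real) \<Rightarrow> real set \<Rightarrow> bool" where
  "Ck_on k f S \<longleftrightarrow>
     (\<forall>j<k. \<forall>x\<in>S. ((deriv ^^ j) f) differentiable (at x)) \<and>
     (\<forall>j\<le>k. continuous_on S ((deriv ^^ j) f))"

definition gradient :: "('a::euclidean_space \<Rightarrow> real) \<Rightarrow> 'a \<Rightarrow> 'a" where
  "gradient f x = (THE g. (f has_derivative (\<lambda>y. g \<bullet> y)) (at x))"

definition second_dir_deriv :: "('a::euclidean_space \<Rightarrow> real) \<Rightarrow> 'a \<Rightarrow> 'a \<Rightarrow> 'a \<Rightarrow> real" where
  "second_dir_deriv f x a b =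
     deriv (\<lambda>s. deriv (\<lambda>t. f (x + s *\<^sub>R a + t *\<^sub>R b)) 0) 0"

definition hessian :: "('a::euclidean_space \<Rightarrow> real) \<Rightarrow> 'a \<Rightarrow> 'a \<Rightarrow> 'a" where
  "hessian f x = (THE H. linear H \<and> (\<forall>a b. H a \<bullet> b = a \<bullet> H b) \<and>
     (\<forall>a b. H a \<bullet> b = second_dir_deriv f x a b))"

definition spectral_fun :: "(real \<Rightarrow> real) \<Rightarrow> 'a::euclidean_jordan_algebra \<Rightarrow> real" where
  "spectral_fun h w = jtrace (jfun h w)"

definition homogeneous_on_cone :: "('a::euclidean_jordan_algebra \<Rightarrow> real) \<Rightarrow> bool" where
  "homogeneous_on_cone f \<longleftrightarrow>
     (\<forall>w\<in>interior cone_of_squares. \<forall>t>0. f (t *\<^sub>R w) = t * f w)"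

text \<open>\<open>\<Gamma>\<close> is considered only on the open set \<open>dom_Gamma h\<close>.\<close>

definition dom_Gamma :: "(real \<Rightarrow> real) \<Rightarrow> (real \<times> real \<times> 'a::euclidean_jordan_algebra) set" where
  "dom_Gamma h = {(u, v, w). v > 0 \<and> w \<in> interior cone_of_squares \<and>
     u - v * spectral_fun h (inverse v *\<^sub>R w) > 0}"

definition Gamma_barrier :: "(real \<Rightarrow> real) \<Rightarrow> real \<times> real \<times> 'a::euclidean_jordan_algebra \<Rightarrow> real" where
  "Gamma_barrier h = (\<lambda>(u, v, w).
     - ln (u - v * spectral_fun h (inverse v *\<^sub>R w)) - ln v - ln (jdet w))"

end

theory Submission
  imports Defs
begin

text \<open>
  Write \<open>Q\<close> for the Peirce projections of the frame \<open>c\<close>: \<open>Q i i = P (c i)\<close> and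
  \<open>Q i j = 4 L (c i) L (c j)\<close> for \<open>i < j\<close>. They are self-adjoint, mutually orthogonal and sum to the
  identity (\<open>peirce_compose\<close>, \<open>peirce_selfadjoint\<close>, \<open>peirce_sum\<close>), so the operators
  \<open>\<Sum> m i j Q i j\<close> are composed and inverted entrywise in \<open>m\<close>. The theorem is true because the part of
  the Hessian of \<open>\<Gamma>\<close> that acts on \<open>V\<close> is such an operator, up to terms of low rank.

  The reason is first-order perturbation theory. Near a point with distinct eigenvalues the eigenvalues
  and the frame are differentiable functions of the point, the derivative of the \<open>i\<close>-th eigenvalue in
  direction \<open>a\<close> is \<open>c i \<bullet> a\<close>, and that of the \<open>i\<close>-th frame element is the sum of
  \<open>Q i j a / (ev i - ev j)\<close> over \<open>j \<noteq> i\<close> (\<open>spectral_derivatives\<close>). Once differentiability is known,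
  these values are forced by differentiating \<open>e i \<circ> e i = e i\<close>, \<open>e i \<circ> e j = 0\<close> and
  \<open>y = \<Sum> \<mu> i e i\<close>. Differentiability itself comes from an explicit polynomial: if \<open>P\<close> is the Lagrange
  polynomial of \<open>ev i\<close>, then \<open>3 P\<^sup>2 - 2 P\<^sup>3\<close> takes the values of the indicator of \<open>ev i\<close> on the spectrum
  with vanishing derivative, so at a nearby \<open>y\<close> it differs from an idempotent of \<open>y\<close> only to second
  order (\<open>nearby_idempotent\<close>). That \<open>y\<close> has a spectral decomposition at all is a consequence of the
  linearity of the trace (\<open>spectral_decomp_exists\<close>). The Jordan identity enters only through the
  commutation rules of orthogonal idempotents (\<open>orthogonal_idempotents_commute\<close>,
  \<open>orthogonal_idempotents_half\<close>, \<open>orthogonal_idempotents_triple\<close>).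

  Consequently \<open>x \<mapsto> g(x)\<close> has as its derivative the multiplier with entries the divided differences of
  \<open>g\<close> (\<open>jfun_has_derivative\<close>), and \<open>x \<mapsto> tr (g(x))\<close> has the gradient \<open>g'(x)\<close>
  (\<open>spectral_fun_gradient\<close>). Taking \<open>g = h'\<close> at \<open>\<mu>\<close> and \<open>g = inverse\<close> at \<open>w\<close>, the chain rule gives the
  gradient and the Hessian of the barrier (\<open>barrier_has_gradient\<close>,
  \<open>barrier_gradient_has_derivative\<close>). Convexity of \<open>h\<close> makes every \<open>m i j\<close> and \<open>k3\<close> positive, and
  block elimination then shows that the stated triple is mapped to the right-hand side
  (\<open>barrier_hessian_solution\<close>). Since this works for every right-hand side, the Hessian is onto, hence
  injective, and the triple is the value of its inverse.
\<close>

text \<open>Index sets \<open>{1..n}\<close> keep the form that they have in the definition of a frame.\<close>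

declare One_nat_def [simp del]

section \<open>Jordan products and orthogonal idempotents\<close>

lemma jprod_add_right: "x \<odot> (y + z) = x \<odot> y + x \<odot> (z::'a::jordan_algebra)"
  by (metis jprod_add_left jprod_commute)

lemma jprod_scaleR_right: "x \<odot> (a *\<^sub>R y) = a *\<^sub>R (x \<odot> (y::'a::jordan_algebra))"
  by (metis jprod_scaleR_left jprod_commute)

lemma junit_right: "x \<odot> junit = (x::'a::jordan_algebra)"
  by (metis junit_left jprod_commute)

lemma bounded_bilinear_jprod:
  "bounded_bilinear ((\<odot>) :: 'a::euclidean_jordan_algebra \<Rightarrow> 'a \<Rightarrow> 'a)"
  unfolding bilinear_conv_bounded_bilinear[symmetric] bilinear_def
  by (auto intro!: linearI simp: jprod_add_left jprod_add_right jprod_scaleR_left jprod_scaleR_right)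

interpretation jprod: bounded_bilinear "(\<odot>) :: 'a::euclidean_jordan_algebra \<Rightarrow> 'a \<Rightarrow> 'a"
  by (rule bounded_bilinear_jprod)

text \<open>
  The part of the Jordan identity \<open>z\<^sup>2 (z u) = z (z\<^sup>2 u)\<close> at \<open>z = c + x\<close> that is linear in \<open>x\<close>. It is
  isolated by subtracting the value at \<open>c - x\<close>, which cancels the even parts, and then the cubic part.
\<close>

lemma jordan_identity_linearised:
  fixes c x u :: "'a::euclidean_jordan_algebra"
  shows "(c \<odot> c) \<odot> (x \<odot> u) + 2 *\<^sub>R ((x \<odot> c) \<odot> (c \<odot> u))
       = x \<odot> ((c \<odot> c) \<odot> u) + 2 *\<^sub>R (c \<odot> ((x \<odot> c) \<odot> u))"
proof -
  define F where "F z = (z \<odot> z) \<odot> (z \<odot> u) - z \<odot> ((z \<odot> z) \<odot> u)" for z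
  have F0: "F z = 0" for z
    by (simp add: F_def jordan_identity)
  have eq: "c \<odot> x = x \<odot> c" by (rule jprod_commute)
  have "2 *\<^sub>R (c \<odot> c \<odot> (x \<odot> u) + 2 *\<^sub>R ((x \<odot> c) \<odot> (c \<odot> u))
        - (x \<odot> ((c \<odot> c) \<odot> u) + 2 *\<^sub>R (c \<odot> ((x \<odot> c) \<odot> u))))
      = F (c + x) - F (c - x) - 2 *\<^sub>R F x"
    unfolding F_def
    by (simp add: jprod.add_left jprod.add_right jprod.diff_left jprod.diff_right eq
        scaleR_2 algebra_simps)
  then show ?thesis by (simp add: F0)
qed

lemma orthogonal_idempotents_commute:
  fixes a b x :: "'a::euclidean_jordan_algebra"
  assumes "a \<odot> a = a" "a \<odot> b = 0"
  shows "a \<odot> (b \<odot> x) = b \<odot> (a \<odot> x)"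
  using jordan_identity_linearised[of a b x] assms
  by (simp add: jprod_commute[of b a] jprod.zero_left jprod.zero_right)

text \<open>
  The linearised identity with \<open>c = a\<close> and \<open>u = b\<close>, where orthogonality removes all terms but two.
\<close>

lemma orthogonal_idempotents_half:
  fixes a b x :: "'a::euclidean_jordan_algebra"
  assumes "a \<odot> a = a" "a \<odot> b = 0"
  shows "2 *\<^sub>R (a \<odot> (a \<odot> (b \<odot> x))) = a \<odot> (b \<odot> x)"
proof -
  have "a \<odot> (b \<odot> x) = 2 *\<^sub>R (a \<odot> (b \<odot> (a \<odot> x)))"
    using jordan_identity_linearised[of a x b] assms
    by (simp add: jprod_commute[of x b] jprod_commute[of x a] jprod_commute[of "a \<odot> x" b]
        jprod.zero_left jprod.zero_right)
  then show ?thesis using orthogonal_idempotents_commute[OF assms] by metis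
qed

text \<open>
  Comparing \<open>orthogonal_idempotents_half\<close> for \<open>a\<close>, \<open>b\<close> and the idempotent \<open>a + b\<close> leaves only the
  mixed term \<open>4 a (b (c x))\<close>.
\<close>

lemma orthogonal_idempotents_triple:
  fixes a b c x :: "'a::euclidean_jordan_algebra"
  assumes "a \<odot> a = a" "b \<odot> b = b" "c \<odot> c = c" "a \<odot> b = 0" "a \<odot> c = 0" "b \<odot> c = 0"
  shows "a \<odot> (b \<odot> (c \<odot> x)) = 0"
proof -
  have "(a + b) \<odot> (a + b) = a + b" "(a + b) \<odot> c = 0"
    using assms by (simp_all add: jprod.add_left jprod.add_right jprod_commute[of b a])
  note * = orthogonal_idempotents_half[OF this, of x]
  note ** = orthogonal_idempotents_half[OF assms(1,5), of x]
    orthogonal_idempotents_half[OF assms(2,6), of x]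
  have "b \<odot> (a \<odot> (c \<odot> x)) = a \<odot> (b \<odot> (c \<odot> x))"
    using orthogonal_idempotents_commute[OF assms(1,4)] by simp
  with * ** have "4 *\<^sub>R (a \<odot> (b \<odot> (c \<odot> x))) = 0"
    by (simp add: jprod.add_left jprod.add_right scaleR_add_right scaleR_2 
       scaleR_left_distrib[of 2 2, simplified])
  then show ?thesis by simp
qed

section \<open>Frames and spectral decompositions\<close>

lemma
  assumes "jordan_frame n (c :: nat \<Rightarrow> 'a::jordan_algebra)"
  shows frame_idem: "i \<in> {1..n} \<Longrightarrow> c i \<odot> c i = c i"
    and frame_nonzero: "i \<in> {1..n} \<Longrightarrow> c i \<noteq> 0"
    and frame_orth: "i \<in> {1..n} \<Longrightarrow> j \<in> {1..n} \<Longrightarrow> i \<noteq> j \<Longrightarrow> c i \<odot> c j = 0"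
    and frame_sum: "(\<Sum>i=1..n. c i) = junit"
  using assms unfolding jordan_frame_def primitive_idempotent_def idempotent_def by auto

lemma frame_jprod_elem:
  fixes c :: "nat \<Rightarrow> 'a::euclidean_jordan_algebra"
  assumes "jordan_frame n c" "j \<in> {1..n}"
  shows "(\<Sum>i=1..n. a i *\<^sub>R c i) \<odot> c j = a j *\<^sub>R c j"
proof -
  have "(\<Sum>i=1..n. a i *\<^sub>R c i) \<odot> c j = (\<Sum>i=1..n. if i = j then a j *\<^sub>R c j else 0)"
    unfolding jprod.sum_left
    using assms by (intro sum.cong refl) (auto simp: jprod.scaleR_left frame_idem frame_orth)
  then show ?thesis using assms(2) by simp
qed

lemma frame_jprod:
  fixes c :: "nat \<Rightarrow> 'a::euclidean_jordan_algebra"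
  assumes "jordan_frame n c"
  shows "(\<Sum>i=1..n. a i *\<^sub>R c i) \<odot> (\<Sum>i=1..n. b i *\<^sub>R c i) = (\<Sum>i=1..n. (a i * b i) *\<^sub>R c i)"
  unfolding jprod.sum_right
  by (intro sum.cong refl) (simp add: jprod.scaleR_right frame_jprod_elem[OF assms] mult.commute)

lemma frame_coeffs_eq:
  fixes c :: "nat \<Rightarrow> 'a::euclidean_jordan_algebra"
  assumes "jordan_frame n c" "(\<Sum>i=1..n. a i *\<^sub>R c i) = (\<Sum>i=1..n. b i *\<^sub>R c i)" "i \<in> {1..n}"
  shows "a i = b i"
proof -
  have "a i *\<^sub>R c i = b i *\<^sub>R c i"
    unfolding frame_jprod_elem[OF assms(1,3), symmetric] assms(2) ..
  then show ?thesis using frame_nonzero[OF assms(1,3)] by simp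
qed

text \<open>
  The Lagrange polynomial that is \<open>1\<close> at \<open>b\<close> and vanishes on \<open>A\<close>, both as a function \<open>l\<close> on the reals
  and as a map \<open>P\<close> of the algebra, built one root at a time so that \<open>P\<close> is visibly differentiable. The
  second property holds for every spectral decomposition of a point with the same \<open>P\<close> and \<open>l\<close>, and this
  is what makes two decompositions of one point comparable.
\<close>

lemma spectral_interpolation:
  assumes "finite (A :: real set)" "b \<notin> A"
  shows "\<exists>(P :: 'a::euclidean_jordan_algebra \<Rightarrow> 'a) l. (\<forall>x. P differentiable (at x)) \<and>
      (\<forall>n x ev c. spectral_decomp n x ev c \<longrightarrow> P x = (\<Sum>i=1..n. l (ev i) *\<^sub>R c i)) \<and>
      l b = 1 \<and> (\<forall>a\<in>A. l a = 0)"
  using assms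
proof (induction A)
  case empty
  show ?case
    by (intro exI[of _ "\<lambda>x. junit"] exI[of _ "\<lambda>x. 1"])
       (auto simp: spectral_decomp_def frame_sum)
next
  case (insert a A)
  then have "\<exists>(P :: 'a \<Rightarrow> 'a) l. (\<forall>x. P differentiable (at x)) \<and>
    (\<forall>n x ev c. spectral_decomp n x ev c \<longrightarrow> P x = (\<Sum>i=1..n. l (ev i) *\<^sub>R c i)) \<and>
    l b = 1 \<and> (\<forall>a\<in>A. l a = 0)" by simp
  then obtain P :: "'a \<Rightarrow> 'a" and l where P: "\<forall>x. P differentiable (at x)"
    and Pl0: "\<forall>n x ev c. spectral_decomp n x ev c \<longrightarrow> P x = (\<Sum>i=1..n. l (ev i) *\<^sub>R c i)"
    and l: "l b = 1" "\<forall>a\<in>A. l a = 0" by (elim exE conjE)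
  note Pl = Pl0[rule_format]
  define Q where "Q x = inverse (b - a) *\<^sub>R (x \<odot> P x - a *\<^sub>R P x)" for x
  define k where "k t = inverse (b - a) * ((t - a) * l t)" for t
  have "Q differentiable (at x)" for x
  proof -
    obtain D where "(P has_derivative D) (at x)" using P unfolding differentiable_def by blast
    then show ?thesis unfolding Q_def differentiable_def
      by (intro exI) (rule derivative_eq_intros jprod.FDERIV refl | assumption)+
  qed
  moreover have "Q x = (\<Sum>i=1..n. k (ev i) *\<^sub>R c i)" if s: "spectral_decomp n x ev c" for n x ev c
  proof -
    have fr: "jordan_frame n c" and x: "x = (\<Sum>i=1..n. ev i *\<^sub>R c i)"
      using s by (auto simp: spectral_decomp_def)
    have "x \<odot> P x = (\<Sum>i=1..n. (ev i * l (ev i)) *\<^sub>R c i)"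
      unfolding Pl[OF s] by (subst x, rule frame_jprod[OF fr])
    then show ?thesis
      unfolding Q_def Pl[OF s] k_def by (simp add: scaleR_sum_right sum_subtractf[symmetric])
        (intro sum.cong refl, simp add: algebra_simps)
  qed
  moreover have "k b = 1" "\<forall>t\<in>insert a A. k t = 0" using l insert.prems by (auto simp: k_def)
  ultimately show ?case by blast
qed

text \<open>
  The coefficients of an idempotent in a frame are \<open>0\<close> or \<open>1\<close>, so it is a partial sum of the frame;
  primitivity leaves room for one summand.
\<close>

lemma frame_idempotent_primitive:
  fixes e :: "nat \<Rightarrow> 'a::euclidean_jordan_algebra"
  assumes fr: "jordan_frame n e" and p: "primitive_idempotent x"
    and x: "x = (\<Sum>j=1..n. s j *\<^sub>R e j)"
  shows "\<exists>j\<in>{1..n}. e j = x"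
proof -
  have eq: "(\<Sum>j=1..n. (s j * s j) *\<^sub>R e j) = (\<Sum>j=1..n. s j *\<^sub>R e j)"
    using p frame_jprod[OF fr, of s s] by (simp add: x primitive_idempotent_def idempotent_def)
  have s: "s j = 0 \<or> s j = 1" if "j \<in> {1..n}" for j
    using frame_coeffs_eq[OF fr eq that] by simp
  have "\<exists>j\<in>{1..n}. s j \<noteq> 0"
    using p by (auto simp: x primitive_idempotent_def intro: ccontr)
  then obtain j where j: "j \<in> {1..n}" "s j = 1" using s by blast
  define b where "b = (\<Sum>k=1..n. (if k = j then 0 else s k) *\<^sub>R e k)"
  have xb: "x = e j + b"
    unfolding x b_def using j
    by (simp add: sum.remove[of _ j])
  have "b \<odot> b = b" unfolding b_def frame_jprod[OF fr]
    using s by (intro sum.cong) auto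
  moreover have "b \<odot> e j = 0" unfolding b_def frame_jprod_elem[OF fr j(1)] by simp
  ultimately have "b = 0"
    using p xb frame_idem[OF fr j(1)] frame_nonzero[OF fr j(1)]
    unfolding primitive_idempotent_def idempotent_def by (metis jprod_commute)
  then show ?thesis using j xb by auto
qed

text \<open>
  Distinct eigenvalues are assumed of one decomposition only. Its frame elements are values of Lagrange
  polynomials at \<open>w\<close>, hence combinations of the other frame \<open>e\<close>, hence elements of it.
\<close>

lemma spectral_decomp_unique:
  fixes w :: "'a::euclidean_jordan_algebra"
  assumes s: "spectral_decomp d w ev c" and inj: "inj_on ev {1..d}"
    and t: "spectral_decomp n w mu e"
  shows "\<exists>\<pi>. bij_betw \<pi> {1..d} {1..n} \<and> (\<forall>i\<in>{1..d}. e (\<pi> i) = c i \<and> mu (\<pi> i) = ev i)"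
proof -
  have fc: "jordan_frame d c" and fe: "jordan_frame n e"
    and wc: "w = (\<Sum>i=1..d. ev i *\<^sub>R c i)" and we: "w = (\<Sum>i=1..n. mu i *\<^sub>R e i)"
    using s t by (auto simp: spectral_decomp_def)
  have "\<exists>j\<in>{1..n}. e j = c i" if i: "i \<in> {1..d}" for i
  proof -
    have nb: "ev i \<notin> ev ` ({1..d} - {i})"
      using inj_on_image_mem_iff[OF inj i, of "{1..d} - {i}"] by blast
    have fin: "finite (ev ` ({1..d} - {i}))" by simp
    obtain P :: "'a \<Rightarrow> 'a" and l where
      Pl: "\<forall>n x ev c. spectral_decomp n x ev c \<longrightarrow> P x = (\<Sum>i=1..n. l (ev i) *\<^sub>R c i)"
      and l: "l (ev i) = 1" "\<forall>a\<in>ev ` ({1..d} - {i}). l a = 0"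
      using spectral_interpolation[OF fin nb] by (elim exE conjE)
    have "(\<Sum>k=1..d. l (ev k) *\<^sub>R c k) = (\<Sum>k=1..d. if k = i then c i else 0)"
      using l by (intro sum.cong refl) simp
    then have ci: "c i = (\<Sum>j=1..n. l (mu j) *\<^sub>R e j)"
      using Pl[rule_format, OF s] Pl[rule_format, OF t] i by simp
    have "primitive_idempotent (c i)" using fc i by (auto simp: jordan_frame_def)
    then show ?thesis using frame_idempotent_primitive[OF fe _ ci] by simp
  qed
  then obtain \<pi> where \<pi>: "\<And>i. i \<in> {1..d} \<Longrightarrow> \<pi> i \<in> {1..n} \<and> e (\<pi> i) = c i" by metis
  have "inj_on \<pi> {1..d}"
  proof (rule inj_onI)
    fix i j assume ij: "i \<in> {1..d}" "j \<in> {1..d}" "\<pi> i = \<pi> j"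
    then have "c i = c j" using \<pi> by metis
    then show "i = j"
      using frame_orth[OF fc ij(1,2)] frame_idem[OF fc ij(1)] frame_nonzero[OF fc ij(1)] by auto
  qed
  moreover have "{1..n} \<subseteq> \<pi> ` {1..d}"
  proof
    fix j assume j: "j \<in> {1..n}"
    show "j \<in> \<pi> ` {1..d}"
    proof (rule ccontr)
      assume "j \<notin> \<pi> ` {1..d}"
      then have "\<pi> i \<noteq> j" if "i \<in> {1..d}" for i using that by auto
      then have "e j \<odot> c i = 0" if "i \<in> {1..d}" for i
        using frame_orth[OF fe j, of "\<pi> i"] \<pi>[OF that] that by fastforce
      then have "e j \<odot> junit = 0"
        unfolding frame_sum[OF fc, symmetric] jprod.sum_right by simp
      then show False using frame_nonzero[OF fe j] by (simp add: junit_right)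
    qed
  qed
  ultimately have "bij_betw \<pi> {1..d} {1..n}" using \<pi> by (auto simp: bij_betw_def)
  moreover have "mu (\<pi> i) = ev i" if i: "i \<in> {1..d}" for i
  proof -
    have "ev i *\<^sub>R c i = w \<odot> c i" unfolding wc frame_jprod_elem[OF fc i] ..
    also have "\<dots> = w \<odot> e (\<pi> i)" using \<pi>[OF i] by simp
    also have "\<dots> = mu (\<pi> i) *\<^sub>R e (\<pi> i)"
      unfolding we using frame_jprod_elem[OF fe] \<pi>[OF i] by blast
    finally show ?thesis using \<pi>[OF i] frame_nonzero[OF fc i] by simp
  qed
  ultimately show ?thesis using \<pi> by blast
qed

lemma spectral_sum_unique:
  fixes w :: "'a::euclidean_jordan_algebra"
  assumes s: "spectral_decomp d w ev c" and inj: "inj_on ev {1..d}"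
    and t: "spectral_decomp n w mu e"
  shows "(\<Sum>i=1..n. G (mu i) (e i)) = (\<Sum>i=1..d. G (ev i) (c i) :: 'b::comm_monoid_add)"
    and "(\<Prod>i=1..n. g (mu i)) = (\<Prod>i=1..d. g (ev i) :: 'c::comm_monoid_mult)"
proof -
  obtain \<pi> where p: "bij_betw \<pi> {1..d} {1..n}"
    "\<forall>i\<in>{1..d}. e (\<pi> i) = c i \<and> mu (\<pi> i) = ev i"
    using spectral_decomp_unique[OF assms] by blast
  show "(\<Sum>i=1..n. G (mu i) (e i)) = (\<Sum>i=1..d. G (ev i) (c i))"
    unfolding sum.reindex_bij_betw[OF p(1), symmetric] using p by (intro sum.cong) auto
  show "(\<Prod>i=1..n. g (mu i)) = (\<Prod>i=1..d. g (ev i))"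
    unfolding prod.reindex_bij_betw[OF p(1), symmetric] using p by (intro prod.cong) auto
qed

text \<open>
  At points with distinct eigenvalues the description operators behind \<open>jfun\<close>, \<open>jdet\<close> and \<open>jtrace\<close>
  have a unique witness.
\<close>

lemma
  fixes w :: "'a::euclidean_jordan_algebra"
  assumes "spectral_decomp d w ev c" "inj_on ev {1..d}"
  shows jfun_distinct: "jfun f w = (\<Sum>i=1..d. f (ev i) *\<^sub>R c i)"
    and jdet_distinct: "jdet w = (\<Prod>i=1..d. ev i)"
    and jtrace_distinct: "jtrace w = (\<Sum>i=1..d. ev i)"
  unfolding jfun_def jdet_def jtrace_def
  using spectral_sum_unique(1)[OF assms, of _ _ _ "\<lambda>t x. f t *\<^sub>R x"]
    spectral_sum_unique(1)[OF assms, of _ _ _ "\<lambda>t x. t"]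
    spectral_sum_unique(2)[OF assms, of _ _ _ "\<lambda>t. t"] assms(1)
  by (intro the_equality; blast)+

lemma jtrace_eq_inner: "jtrace z = junit \<bullet> (z :: 'a::euclidean_jordan_algebra)"
  by (simp add: inner_eq_jtrace junit_left)

text \<open>
  The trace is a linear functional, namely the inner product with the unit, and it is the sum of the
  eigenvalues whenever these are distinct. Changing a single coefficient, here \<open>i\<close> to \<open>0\<close> among the
  coefficients \<open>1, \<dots>, n\<close>, isolates the trace of \<open>c i\<close>.
\<close>

lemma frame_trace:
  fixes c :: "nat \<Rightarrow> 'a::euclidean_jordan_algebra"
  assumes fr: "jordan_frame n c" and i: "i \<in> {1..n}"
  shows "junit \<bullet> c i = 1"
proof -
  have *: "(\<Sum>k=1..n. ev k * (junit \<bullet> c k)) = (\<Sum>k=1..n. ev k)" if "inj_on ev {1..n}" for ev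
    using jtrace_distinct[OF _ that, of "\<Sum>k=1..n. ev k *\<^sub>R c k" c] fr
    by (simp add: spectral_decomp_def jtrace_eq_inner inner_sum_right)
  define ev where "ev k = (if k = i then 0 else real k)" for k
  have "(\<Sum>k=1..n. real k * (junit \<bullet> c k)) = (\<Sum>k=1..n. real k)" 
    "(\<Sum>k=1..n. ev k * (junit \<bullet> c k)) = (\<Sum>k=1..n. ev k)"
    by (rule *; auto simp: inj_on_def ev_def split: if_splits)+
  then have "real i * (junit \<bullet> c i) = real i"
    using i by (simp add: sum.remove[of _ i] ev_def)
  then show ?thesis using i by simp
qed

lemma frame_inner:
  fixes c :: "nat \<Rightarrow> 'a::euclidean_jordan_algebra"
  assumes fr: "jordan_frame n c" and "i \<in> {1..n}" "j \<in> {1..n}"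
  shows "c i \<bullet> c j = (if i = j then 1 else 0)"
proof -
  have "c i \<bullet> c j = (c i \<odot> junit) \<bullet> c j" by (simp add: junit_right)
  also have "\<dots> = junit \<bullet> (c i \<odot> c j)" by (simp add: inner_jprod)
  finally show ?thesis using assms by (auto simp: frame_idem frame_orth frame_trace)
qed

text \<open>
  All frames have the same number of elements, the squared norm of the unit.
\<close>

lemma frame_size:
  fixes c :: "nat \<Rightarrow> 'a::euclidean_jordan_algebra"
  assumes fr: "jordan_frame n c"
  shows "real n = junit \<bullet> (junit :: 'a)"
proof -
  have "junit \<bullet> (junit :: 'a) = (\<Sum>i=1..n. junit \<bullet> c i)"
    unfolding inner_sum_right[symmetric] frame_sum[OF fr] ..
  also have "\<dots> = real n" using frame_trace[OF fr] by simp
  finally show ?thesis by simp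
qed

text \<open>
  The spectral theorem is forced by linearity of the trace. At a point without a spectral decomposition
  the trace takes a default value that does not depend on the point. The set of these points is stable
  under doubling and under adding the unit; so the default value is \<open>0\<close>, and the unit has trace \<open>0\<close>, which
  is impossible because its trace is its squared norm.
\<close>

lemma spectral_decomp_exists:
  fixes z :: "'a::euclidean_jordan_algebra"
  shows "\<exists>n ev c. spectral_decomp n z ev c"
proof (rule ccontr)
  assume z: "\<nexists>n ev c. spectral_decomp n z ev c"
  have tr: "jtrace y = (THE t::real. False)" if "\<nexists>n ev c. spectral_decomp n y ev c" for y :: 'a
    using that by (auto simp: jtrace_def intro!: arg_cong[where f = The])
  have dbl: "\<nexists>n ev c. spectral_decomp n (2 *\<^sub>R y) ev c"
    if "\<nexists>n ev c. spectral_decomp n y ev c" for y :: 'a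
  proof
    assume "\<exists>n ev c. spectral_decomp n (2 *\<^sub>R y) ev c"
    then obtain n ev c where "jordan_frame n c" "2 *\<^sub>R y = (\<Sum>i=1..n. ev i *\<^sub>R c i)"
      by (auto simp: spectral_decomp_def)
    moreover have "y = (1/2) *\<^sub>R (2 *\<^sub>R y)" by simp
    moreover have "(1/2) *\<^sub>R (\<Sum>i=1..n. ev i *\<^sub>R c i) = (\<Sum>i=1..n. (ev i / 2) *\<^sub>R c i)"
      by (simp add: scaleR_sum_right)
    ultimately have "spectral_decomp n y (\<lambda>i. ev i / 2) c"
      unfolding spectral_decomp_def by metis
    then show False using that by blast
  qed
  have zero: "junit \<bullet> y = 0" if "\<nexists>n ev c. spectral_decomp n y ev c" for y :: 'a
    using tr[OF that] tr[OF dbl[OF that]] by (simp add: jtrace_eq_inner)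
  have "\<nexists>n ev c. spectral_decomp n (z + junit) ev c"
  proof
    assume "\<exists>n ev c. spectral_decomp n (z + junit) ev c"
    then obtain n ev c where fr: "jordan_frame n c" and e: "z + junit = (\<Sum>i=1..n. ev i *\<^sub>R c i)"
      by (auto simp: spectral_decomp_def)
    have "z = (\<Sum>i=1..n. ev i *\<^sub>R c i) - (\<Sum>i=1..n. c i)"
      using e frame_sum[OF fr] by (metis add_diff_cancel_right')
    also have "\<dots> = (\<Sum>i=1..n. (ev i - 1) *\<^sub>R c i)"
      by (simp add: scaleR_diff_left sum_subtractf)
    finally show False using z fr unfolding spectral_decomp_def by metis
  qed
  then have "(junit :: 'a) = 0" using zero[of "z + junit"] zero[OF z] by (simp add: inner_add_right)
  then have "x = 0" for x :: 'a by (metis junit_left jprod.zero_left)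
  then show False using nonzero_Basis nonempty_Basis by blast
qed

section \<open>Perturbation of a spectral decomposition with distinct eigenvalues\<close>

lemma has_derivative_locally_Lipschitz:
  assumes "(f has_derivative f') (at x)"
  shows "\<exists>K\<ge>0. \<forall>\<^sub>F y in nhds x. norm (f y - f x) \<le> K * norm (y - x)"
proof -
  interpret f': bounded_linear f' using assms by (rule has_derivative_bounded_linear)
  obtain B where B: "B > 0" "\<And>y. norm (f' y) \<le> norm y * B" using f'.pos_bounded by blast
  obtain e where e: "e > 0" "\<And>y. norm (y - x) < e \<Longrightarrow> norm (f y - f x - f' (y - x)) \<le> norm (y - x)"
    using assms unfolding has_derivative_at_alt by (metis mult_1 zero_less_one)
  have "norm (f y - f x) \<le> (1 + B) * norm (y - x)" if "norm (y - x) < e" for y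
    using norm_triangle_ineq[of "f y - f x - f' (y - x)" "f' (y - x)"] e(2)[OF that] B(2)[of "y - x"]
    by (simp add: algebra_simps)
  then have "\<forall>\<^sub>F y in nhds x. norm (f y - f x) \<le> (1 + B) * norm (y - x)"
    using e(1) by (auto simp: eventually_nhds_metric dist_norm)
  then show ?thesis using B(1) by (intro exI[of _ "1 + B"]) auto
qed

lemma has_derivative_quadratic_perturbation:
  fixes f g :: "'a::real_normed_vector \<Rightarrow> 'b::real_normed_vector"
  assumes f: "(f has_derivative f') (at x)"
    and C: "\<forall>\<^sub>F y in nhds x. norm (g y - f y) \<le> C * (norm (y - x))\<^sup>2"
  shows "(g has_derivative f') (at x)"
proof -
  have eq: "g x = f x" using eventually_nhds_x_imp_x[OF C] by simp
  have "((\<lambda>y. g y - f y) has_derivative (\<lambda>_. 0)) (at x)"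
    unfolding has_derivative_at_alt
  proof (intro conjI allI impI bounded_linear_zero)
    fix e :: real assume e: "e > 0"
    obtain r where r: "r > 0" "\<And>y. dist y x < r \<Longrightarrow> norm (g y - f y) \<le> C * (norm (y - x))\<^sup>2"
      using C by (auto simp: eventually_nhds_metric)
    define s where "s = min r (e / (\<bar>C\<bar> + 1))"
    have "norm (g y - f y - (g x - f x) - 0) \<le> e * norm (y - x)" if y: "norm (y - x) < s" for y
    proof -
      have "norm (g y - f y) \<le> C * (norm (y - x))\<^sup>2" using r(2)[of y] y by (simp add: s_def dist_norm)
      also have "\<dots> \<le> (\<bar>C\<bar> + 1) * (norm (y - x))\<^sup>2" by (intro mult_right_mono) auto
      also have "\<dots> = ((\<bar>C\<bar> + 1) * norm (y - x)) * norm (y - x)" by (simp add: power2_eq_square)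
      also have "\<dots> \<le> e * norm (y - x)"
        using y by (intro mult_right_mono) (auto simp: s_def field_simps)
      finally show ?thesis using eq by simp
    qed
    moreover have "s > 0" using r(1) e by (simp add: s_def)
    ultimately show "\<exists>d>0. \<forall>y. norm (y - x) < d \<longrightarrow>
        norm (g y - f y - (g x - f x) - 0) \<le> e * norm (y - x)" by blast
  qed
  from has_derivative_add[OF f this] show ?thesis by simp
qed

lemma isCont_tendsto_nhds: "isCont f x \<Longrightarrow> f x = l \<Longrightarrow> (f \<longlongrightarrow> l) (nhds x)"
  using tendsto_at_iff_tendsto_nhds[of f x] by (simp add: isCont_def)

text \<open>
  The polynomial \<open>3 s\<^sup>2 - 2 s\<^sup>3\<close> has fixed points with zero slope at \<open>0\<close> and \<open>1\<close>, so it turns an error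
  \<open>\<eta>\<close> in \<open>s\<^sup>2 = s\<close> into an error of order \<open>\<eta>\<^sup>2\<close>.
\<close>

lemma almost_zero_or_one:
  fixes s \<eta> :: real
  assumes "\<bar>s\<^sup>2 - s\<bar> \<le> \<eta>" "\<eta> \<le> 1/8"
  defines "b \<equiv> (if s > 1/2 then 1 else 0)"
  shows "\<bar>s - b\<bar> \<le> 2 * \<eta>" "\<bar>b - (3 * s\<^sup>2 - 2 * s^3)\<bar> \<le> 16 * \<eta>\<^sup>2"
proof -
  show 1: "\<bar>s - b\<bar> \<le> 2 * \<eta>"
  proof (cases "s > 1/2")
    case True
    have "\<bar>s - 1\<bar> * (1/2) \<le> \<bar>s - 1\<bar> * \<bar>s\<bar>" using True by (intro mult_left_mono) auto
    also have "\<dots> = \<bar>s\<^sup>2 - s\<bar>" by (simp add: abs_mult[symmetric] power2_eq_square algebra_simps)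
    finally show ?thesis using assms(1) True by (simp add: b_def)
  next
    case False
    have "\<bar>s\<bar> * (1/2) \<le> \<bar>s\<bar> * \<bar>s - 1\<bar>" using False by (intro mult_left_mono) auto
    also have "\<dots> = \<bar>s\<^sup>2 - s\<bar>" by (simp add: abs_mult[symmetric] power2_eq_square algebra_simps)
    finally show ?thesis using assms(1) False by (simp add: b_def)
  qed
  have \<eta>: "\<eta> \<ge> 0" using assms(1) abs_ge_zero order_trans by blast
  have sq: "(s - b)\<^sup>2 \<le> 4 * \<eta>\<^sup>2"
    using power_mono[OF 1, of 2] by (simp add: power_mult_distrib)
  have eq: "\<bar>b - (3 * s\<^sup>2 - 2 * s^3)\<bar> = (s - b)\<^sup>2 * \<bar>3 - 2 * \<bar>s - b\<bar>\<bar>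
      \<or> \<bar>b - (3 * s\<^sup>2 - 2 * s^3)\<bar> = (s - b)\<^sup>2 * \<bar>3 + 2 * \<bar>s - b\<bar>\<bar>"
  proof -
    have "b - (3 * s\<^sup>2 - 2 * s^3) = (s - b)\<^sup>2 * (3 + 2 * (s - b)) \<or>
          b - (3 * s\<^sup>2 - 2 * s^3) = - ((s - b)\<^sup>2 * (3 - 2 * (s - b)))"
      by (simp add: b_def power2_eq_square power3_eq_cube algebra_simps)
    then show ?thesis by (cases "s \<ge> b") (auto simp: abs_mult)
  qed
  have "\<bar>3 - 2 * a\<bar> \<le> 4 \<and> \<bar>3 + 2 * a\<bar> \<le> 4" if "0 \<le> a" "a \<le> 1/4" for a :: real
    using that by (auto simp: abs_if)
  moreover have "0 \<le> \<bar>s - b\<bar>" by simp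
  moreover have "\<bar>s - b\<bar> \<le> 1/4" using 1 assms(2) by simp
  ultimately have "\<bar>3 - 2 * \<bar>s - b\<bar>\<bar> \<le> 4" "\<bar>3 + 2 * \<bar>s - b\<bar>\<bar> \<le> 4" by blast+
  then have "\<bar>b - (3 * s\<^sup>2 - 2 * s^3)\<bar> \<le> (s - b)\<^sup>2 * 4"
    using eq by (auto intro!: mult_left_mono)
  then show "\<bar>b - (3 * s\<^sup>2 - 2 * s^3)\<bar> \<le> 16 * \<eta>\<^sup>2" using sq by simp
qed

text \<open>
  Rounding changes the sum by at most \<open>1/4\<close>, and the rounded sum is an integer.
\<close>

lemma exactly_one_almost_one:
  fixes s :: "nat \<Rightarrow> real" and \<eta> :: real
  assumes "finite I" and s: "\<And>k. k \<in> I \<Longrightarrow> \<bar>(s k)\<^sup>2 - s k\<bar> \<le> \<eta>" and "\<eta> \<le> 1/8"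
    and "card I * \<eta> \<le> 1/8" and "\<bar>(\<Sum>k\<in>I. s k) - 1\<bar> < 1/4"
  shows "\<exists>j\<in>I. \<forall>k\<in>I. s k > 1/2 \<longleftrightarrow> k = j"
proof -
  define S where "S = {k\<in>I. s k > 1/2}"
  have "\<bar>(\<Sum>k\<in>I. s k) - (\<Sum>k\<in>I. if s k > 1/2 then 1 else 0)\<bar> \<le> (\<Sum>k\<in>I. 2 * \<eta>)"
    unfolding sum_subtractf[symmetric]
    by (rule order_trans[OF sum_abs sum_mono]) (rule almost_zero_or_one(1)[OF s assms(3)])
  also have "\<dots> \<le> 1/4" using assms(4) by simp
  also have "(\<Sum>k\<in>I. if s k > 1/2 then 1 else 0) = real (card S)"
    unfolding S_def using assms(1) by (simp add: sum.If_cases Int_def)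
  finally have "\<bar>real (card S) - 1\<bar> < 1" using assms(5) by linarith
  then have "card S = 1" by linarith
  then obtain j where "S = {j}" by (rule card_1_singletonE)
  then show ?thesis unfolding S_def by blast
qed

lemma frame_norm:
  fixes c :: "nat \<Rightarrow> 'a::euclidean_jordan_algebra"
  shows "jordan_frame n c \<Longrightarrow> i \<in> {1..n} \<Longrightarrow> norm (c i) = 1"
  using frame_inner[of n c i i] by (simp add: norm_eq_sqrt_inner)

text \<open>
  At \<open>w\<close> the Lagrange polynomial \<open>P\<close> of \<open>ev i\<close> satisfies \<open>P\<^sup>2 = P\<close> and has trace \<open>1\<close>. Both persist
  approximately at nearby \<open>y\<close>, where \<open>P y\<close> therefore has exactly one coefficient close to \<open>1\<close> in any
  frame of \<open>y\<close>, all others being close to \<open>0\<close>. The trace thus counts the frame elements that \<open>c i\<close>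
  can split into, and no continuity of the frame has to be assumed. The error of \<open>Q = 3 P\<^sup>2 - 2 P\<^sup>3\<close> is
  quadratic, which is what transfers differentiability from \<open>Q\<close> to the frame.
\<close>

lemma nearby_idempotent:
  fixes w :: "'a::euclidean_jordan_algebra"
  assumes s: "spectral_decomp d w ev c" and inj: "inj_on ev {1..d}" and i: "i \<in> {1..d}"
  shows "\<exists>(Q :: 'a \<Rightarrow> 'a) C. Q differentiable (at w) \<and> Q w = c i \<and>
    (\<forall>\<^sub>F y in nhds w. \<forall>mu e. spectral_decomp d y mu e \<longrightarrow>
       (\<exists>j\<in>{1..d}. norm (e j - Q y) \<le> C * (norm (y - w))\<^sup>2))"
proof -
  have fc: "jordan_frame d c" using s by (auto simp: spectral_decomp_def)
  have nb: "ev i \<notin> ev ` ({1..d} - {i})"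
    using inj_on_image_mem_iff[OF inj i, of "{1..d} - {i}"] by blast
  have fin: "finite (ev ` ({1..d} - {i}))" by simp
  obtain P :: "'a \<Rightarrow> 'a" and l where P: "\<forall>x. P differentiable (at x)"
    and Pl: "\<forall>n x ev c. spectral_decomp n x ev c \<longrightarrow> P x = (\<Sum>i=1..n. l (ev i) *\<^sub>R c i)"
    and l: "l (ev i) = 1" "\<forall>a\<in>ev ` ({1..d} - {i}). l a = 0"
    using spectral_interpolation[OF fin nb] by (elim exE conjE)
  have "(\<Sum>k=1..d. l (ev k) *\<^sub>R c k) = (\<Sum>k=1..d. if k = i then c i else 0)"
    using l by (intro sum.cong refl) simp
  then have Pw: "P w = c i" using Pl[rule_format, OF s] i by simp
  define F where "F y = P y \<odot> P y - P y" for y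
  define Q where "Q y = 3 *\<^sub>R (P y \<odot> P y) - 2 *\<^sub>R (P y \<odot> (P y \<odot> P y))" for y
  obtain D where D: "(P has_derivative D) (at w)" using P unfolding differentiable_def by blast
  have "F differentiable (at w)" unfolding F_def differentiable_def
    by (intro exI) (rule derivative_eq_intros jprod.FDERIV refl D)+
  then obtain DF where DF: "(F has_derivative DF) (at w)" unfolding differentiable_def by blast
  have Qd: "Q differentiable (at w)" unfolding Q_def differentiable_def
    by (intro exI) (rule derivative_eq_intros jprod.FDERIV refl D)+
  have Fw: "F w = 0" and Qw: "Q w = c i"
    unfolding F_def Q_def Pw using frame_idem[OF fc i] by (simp_all add: scaleR_left_diff_distrib[symmetric])
  obtain K where K: "K \<ge> 0" "\<forall>\<^sub>F y in nhds w. norm (F y) \<le> K * norm (y - w)"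
    using has_derivative_locally_Lipschitz[OF DF] Fw by auto
  \<comment> \<open>The radius makes \<open>d \<eta> \<le> 1/8\<close> below, where \<open>\<eta>\<close> is the norm of \<open>F y\<close>.\<close>
  have small: "\<forall>\<^sub>F y in nhds w. norm (y - w) < 1 / (8 * (K + 1) * (real d + 1))"
    unfolding eventually_nhds_metric using K(1)
    by (intro exI[of _ "1 / (8 * (K + 1) * (real d + 1))"]) (auto simp: dist_norm)
  have "isCont P w" using D has_derivative_continuous by blast
  then have "isCont (\<lambda>y. junit \<bullet> P y) w" by (intro continuous_intros)
  then have "((\<lambda>y. junit \<bullet> P y) \<longlongrightarrow> 1) (nhds w)"
    using frame_trace[OF fc i] Pw by (intro isCont_tendsto_nhds) auto
  then have tr: "\<forall>\<^sub>F y in nhds w. \<bar>junit \<bullet> P y - 1\<bar> < 1/4"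
    using tendstoD[where e = "1/4"] by (force simp: dist_real_def)
  have "\<forall>\<^sub>F y in nhds w. \<forall>mu e. spectral_decomp d y mu e \<longrightarrow>
       (\<exists>j\<in>{1..d}. norm (e j - Q y) \<le> (d * 16 * K\<^sup>2) * (norm (y - w))\<^sup>2)"
    using K(2) small tr
  proof (eventually_elim, intro allI impI)
    fix y mu e
    assume Fy: "norm (F y) \<le> K * norm (y - w)" and sm: "norm (y - w) < 1 / (8 * (K + 1) * (real d + 1))"
      and tr: "\<bar>junit \<bullet> P y - 1\<bar> < 1/4" and t: "spectral_decomp d y mu e"
    have fe: "jordan_frame d e" using t by (auto simp: spectral_decomp_def)
    define s where "s k = l (mu k)" for k
    define \<eta> where "\<eta> = norm (F y)"
    have Py: "P y = (\<Sum>k=1..d. s k *\<^sub>R e k)" using Pl t unfolding s_def by blast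
    have Fs: "F y = (\<Sum>k=1..d. ((s k)\<^sup>2 - s k) *\<^sub>R e k)"
      unfolding F_def Py frame_jprod[OF fe]
      by (simp add: sum_subtractf[symmetric] scaleR_diff_left[symmetric] power2_eq_square)
    have Qs: "Q y = (\<Sum>k=1..d. (3 * (s k)\<^sup>2 - 2 * s k ^ 3) *\<^sub>R e k)"
      unfolding Q_def Py frame_jprod[OF fe] scaleR_sum_right sum_subtractf[symmetric]
      by (intro sum.cong refl) (simp add: scaleR_diff_left power2_eq_square power3_eq_cube)
    have coeff: "(\<Sum>k=1..d. a k *\<^sub>R e k) \<bullet> e j = a j" if "j \<in> {1..d}" for a j
    proof -
      have "(\<Sum>k=1..d. a k *\<^sub>R e k) \<bullet> e j = (\<Sum>k=1..d. if k = j then a j else 0)"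
        unfolding inner_sum_left using frame_inner[OF fe _ that] by (intro sum.cong refl) auto
      then show ?thesis using that by simp
    qed
    have s\<eta>: "\<bar>(s k)\<^sup>2 - s k\<bar> \<le> \<eta>" if "k \<in> {1..d}" for k
      using Cauchy_Schwarz_ineq2[of "F y" "e k"] coeff[OF that, of "\<lambda>k. (s k)\<^sup>2 - s k"]
        frame_norm[OF fe that] by (simp add: Fs[symmetric] \<eta>_def)
    have cancel: "k * (1 / (8 * k * D)) = 1 / (8 * D)" if "k > 0" for k D :: real
      using that by simp
    have "\<eta> \<le> (K + 1) * norm (y - w)" using Fy by (simp add: \<eta>_def distrib_right add_increasing2)
    also have "\<dots> \<le> (K + 1) * (1 / (8 * (K + 1) * (real d + 1)))"
      using sm K(1) by (intro mult_left_mono) auto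
    also have "\<dots> = 1 / (8 * (real d + 1))" using K(1) by (intro cancel) simp
    finally have \<eta>: "\<eta> \<le> 1 / (8 * (real d + 1))" .
    have \<eta>0: "\<eta> \<ge> 0" by (simp add: \<eta>_def)
    have "(real d + 1) * \<eta> \<le> 1/8" using \<eta> by (simp add: field_simps)
    moreover have "0 \<le> real d * \<eta>" using \<eta>0 by simp
    ultimately have \<eta>1: "d * \<eta> \<le> 1/8" "\<eta> \<le> 1/8" using \<eta>0
      unfolding distrib_right mult_1 by linarith+
    have "(\<Sum>k=1..d. s k) = junit \<bullet> P y"
      unfolding Py inner_sum_right using frame_trace[OF fe] by (intro sum.cong refl) simp
    then have "\<exists>j\<in>{1..d}. \<forall>k\<in>{1..d}. s k > 1/2 \<longleftrightarrow> k = j"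
      using s\<eta> \<eta>1 tr by (intro exactly_one_almost_one[where \<eta> = \<eta>]) auto
    then obtain j where j: "j \<in> {1..d}" "\<And>k. k \<in> {1..d} \<Longrightarrow> s k > 1/2 \<longleftrightarrow> k = j" by blast
    have "e j = (\<Sum>k=1..d. (if s k > 1/2 then 1 else 0) *\<^sub>R e k)"
    proof -
      have "(\<Sum>k=1..d. (if s k > 1/2 then 1 else 0) *\<^sub>R e k) = (\<Sum>k=1..d. if k = j then e j else 0)"
        using j(2) by (intro sum.cong refl) auto
      then show ?thesis using j(1) by simp
    qed
    then have "e j - Q y = (\<Sum>k=1..d. ((if s k > 1/2 then 1 else 0) - (3 * (s k)\<^sup>2 - 2 * s k ^ 3)) *\<^sub>R e k)"
      unfolding Qs by (simp add: sum_subtractf[symmetric] scaleR_diff_left[symmetric])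
    also have "norm \<dots> \<le> (\<Sum>k=1..d. 16 * \<eta>\<^sup>2)"
    proof (intro order_trans[OF norm_sum sum_mono])
      fix k assume k: "k \<in> {1..d}"
      show "norm (((if s k > 1/2 then 1 else 0) - (3 * (s k)\<^sup>2 - 2 * s k ^ 3)) *\<^sub>R e k) \<le> 16 * \<eta>\<^sup>2"
        using almost_zero_or_one(2)[OF s\<eta>[OF k] \<eta>1(2)]
        by (simp only: norm_scaleR frame_norm[OF fe k] mult_1_right)
    qed
    also have "\<dots> = (d * 16) * \<eta>\<^sup>2" by simp
    also have "\<dots> \<le> (d * 16) * (K * norm (y - w))\<^sup>2"
      using Fy by (intro mult_left_mono power_mono) (auto simp: \<eta>_def)
    also have "\<dots> = (d * 16 * K\<^sup>2) * (norm (y - w))\<^sup>2" by (simp add: power_mult_distrib)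
    finally show "\<exists>j\<in>{1..d}. norm (e j - Q y) \<le> (d * 16 * K\<^sup>2) * (norm (y - w))\<^sup>2"
      using j(1) by blast
  qed
  then show ?thesis using Qd Qw by blast
qed

lemma frame_reindex:
  assumes "jordan_frame d c" "bij_betw \<pi> {1..d} {1..d}"
  shows "jordan_frame d (\<lambda>i. c (\<pi> i))"
proof -
  have "(\<Sum>i=1..d. c (\<pi> i)) = (\<Sum>i=1..d. c i)" by (rule sum.reindex_bij_betw[OF assms(2)])
  moreover have "\<pi> i \<in> {1..d}" if "i \<in> {1..d}" for i
    using that assms(2) bij_betwE by blast
  moreover have "\<pi> i \<noteq> \<pi> j" if "i \<in> {1..d}" "j \<in> {1..d}" "i \<noteq> j" for i j
    using that assms(2) unfolding bij_betw_def by (meson inj_onD)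
  ultimately show ?thesis using assms(1) unfolding jordan_frame_def by (intro conjI ballI impI) metis+
qed

lemma spectral_coeff:
  fixes w :: "'a::euclidean_jordan_algebra"
  assumes "spectral_decomp n w ev c" "i \<in> {1..n}"
  shows "w \<bullet> c i = ev i"
proof -
  have fr: "jordan_frame n c" and w: "w = (\<Sum>i=1..n. ev i *\<^sub>R c i)"
    using assms by (auto simp: spectral_decomp_def)
  have "w \<bullet> c i = (\<Sum>k=1..n. if k = i then ev i else 0)"
    unfolding w inner_sum_left using frame_inner[OF fr _ assms(2)] by (intro sum.cong refl) auto
  then show ?thesis using assms(2) by simp
qed

text \<open>
  The frame elements found by \<open>nearby_idempotent\<close> for the different \<open>c i\<close> are different because the
  \<open>c i\<close> have distance \<open>\<surd>2\<close>; they thus exhaust a frame of \<open>y\<close>, which can be numbered like \<open>c\<close>. The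
  eigenvalues are recovered from the frame as \<open>y \<bullet> e y i\<close>.
\<close>

lemma spectral_perturbation:
  fixes w :: "'a::euclidean_jordan_algebra"
  assumes s: "spectral_decomp d w ev c" and inj: "inj_on ev {1..d}"
  shows "\<exists>(e :: 'a \<Rightarrow> nat \<Rightarrow> 'a) D.
    (\<forall>\<^sub>F y in nhds w. spectral_decomp d y (\<lambda>i. y \<bullet> e y i) (e y) \<and> inj_on (\<lambda>i. y \<bullet> e y i) {1..d}) \<and>
    (\<forall>i\<in>{1..d}. e w i = c i \<and> ((\<lambda>y. e y i) has_derivative D i) (at w))"
proof -
  have fc: "jordan_frame d c" using s by (auto simp: spectral_decomp_def)
  define R where "R i Q C \<longleftrightarrow> Q differentiable (at w) \<and> Q w = c i \<and>
    (\<forall>\<^sub>F y in nhds w. \<forall>mu e. spectral_decomp d y mu e \<longrightarrow>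
       (\<exists>j\<in>{1..d}. norm (e j - Q y) \<le> C * (norm (y - w))\<^sup>2))" for i and Q :: "'a \<Rightarrow> 'a" and C
  have "\<forall>i\<in>{1..d}. \<exists>Q C. R i Q C"
    unfolding R_def by (intro ballI nearby_idempotent[OF s inj])
  then obtain Q C where R: "\<And>i. i \<in> {1..d} \<Longrightarrow> R i (Q i) (C i)" by metis
  then have Qd: "\<And>i. i \<in> {1..d} \<Longrightarrow> Q i differentiable (at w)"
    and Qw: "\<And>i. i \<in> {1..d} \<Longrightarrow> Q i w = c i"
    and Q: "\<And>i. i \<in> {1..d} \<Longrightarrow> \<forall>\<^sub>F y in nhds w. \<forall>mu e. spectral_decomp d y mu e \<longrightarrow>
       (\<exists>j\<in>{1..d}. norm (e j - Q i y) \<le> C i * (norm (y - w))\<^sup>2)"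
    unfolding R_def by blast+
  have Qc: "((\<lambda>y. norm (Q i y - c i) + C i * (norm (y - w))\<^sup>2) \<longlongrightarrow> 0) (nhds w)" if i: "i \<in> {1..d}" for i
  proof -
    have "isCont (Q i) w" using Qd[OF i] by (rule differentiable_imp_continuous_within)
    then have "isCont (\<lambda>y. norm (Q i y - c i) + C i * (norm (y - w))\<^sup>2) w"
      by (intro continuous_intros)
    then show ?thesis using Qw[OF i] by (intro isCont_tendsto_nhds) auto
  qed
  have near: "\<forall>\<^sub>F y in nhds w. \<forall>i\<in>{1..d}. norm (Q i y - c i) + C i * (norm (y - w))\<^sup>2 < 1/2"
    using order_tendstoD(2)[OF Qc, of _ "1/2"] by (intro eventually_ball_finite) auto
  have Qall: "\<forall>\<^sub>F y in nhds w. \<forall>i\<in>{1..d}. \<forall>mu e. spectral_decomp d y mu e \<longrightarrow>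
       (\<exists>j\<in>{1..d}. norm (e j - Q i y) \<le> C i * (norm (y - w))\<^sup>2)"
    using Q by (intro eventually_ball_finite) auto
  have "\<forall>\<^sub>F y in nhds w. \<exists>e. spectral_decomp d y (\<lambda>i. y \<bullet> e i) e \<and>
      (\<forall>i\<in>{1..d}. norm (e i - Q i y) \<le> C i * (norm (y - w))\<^sup>2)"
    using near Qall
  proof eventually_elim
    case (elim y)
    obtain n mu e where t: "spectral_decomp n y mu e" using spectral_decomp_exists by blast
    have "n = d" using frame_size[OF fc] frame_size[of n e] t by (auto simp: spectral_decomp_def)
    with t have t: "spectral_decomp d y mu e" by simp
    have "\<forall>i\<in>{1..d}. \<exists>j\<in>{1..d}. norm (e j - Q i y) \<le> C i * (norm (y - w))\<^sup>2"
      using elim(2) t by blast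
    then obtain \<pi> where \<pi>: "\<And>i. i \<in> {1..d} \<Longrightarrow> \<pi> i \<in> {1..d}"
      "\<And>i. i \<in> {1..d} \<Longrightarrow> norm (e (\<pi> i) - Q i y) \<le> C i * (norm (y - w))\<^sup>2"
      by metis
    have cl: "norm (e (\<pi> i) - c i) < 1/2" if i: "i \<in> {1..d}" for i
      using norm_triangle_ineq[of "e (\<pi> i) - Q i y" "Q i y - c i"] \<pi>(2)[OF i] bspec[OF elim(1) i] by simp
    have "inj_on \<pi> {1..d}"
    proof (rule inj_onI, rule ccontr)
      fix i j assume ij: "i \<in> {1..d}" "j \<in> {1..d}" "\<pi> i = \<pi> j" "i \<noteq> j"
      have "norm (c i - c j) < 1"
        using norm_triangle_ineq4[of "e (\<pi> i) - c j" "e (\<pi> i) - c i"] cl[OF ij(1)] cl[OF ij(2)] ij(3)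
        by simp
      moreover have "(norm (c i - c j))\<^sup>2 = 2"
        using ij(4) frame_inner[OF fc ij(1,2)] frame_inner[OF fc ij(1,1)] frame_inner[OF fc ij(2,2)]
        by (simp add: power2_norm_eq_inner inner_diff_left inner_diff_right inner_commute)
      moreover have "(norm (c i - c j))\<^sup>2 \<le> 1 ^ 2" using calculation(1) by (intro power_mono) auto
      ultimately show False by simp
    qed
    moreover from this have "\<pi> ` {1..d} = {1..d}"
      using \<pi>(1) by (intro endo_inj_surj) auto
    ultimately have bij: "bij_betw \<pi> {1..d} {1..d}" by (simp add: bij_betw_def)
    have e: "jordan_frame d e" "y = (\<Sum>i=1..d. mu i *\<^sub>R e i)" using t by (auto simp: spectral_decomp_def)
    have "y = (\<Sum>i=1..d. mu (\<pi> i) *\<^sub>R e (\<pi> i))"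
      unfolding e(2) by (rule sum.reindex_bij_betw[OF bij, symmetric])
    also have "\<dots> = (\<Sum>i=1..d. (y \<bullet> e (\<pi> i)) *\<^sub>R e (\<pi> i))"
      using spectral_coeff[OF t \<pi>(1)] by (intro sum.cong refl) simp
    finally have "spectral_decomp d y (\<lambda>i. y \<bullet> e (\<pi> i)) (\<lambda>i. e (\<pi> i))"
      unfolding spectral_decomp_def using frame_reindex[OF e(1) bij] by blast
    then show ?case using \<pi>(2) by (intro exI[of _ "\<lambda>i. e (\<pi> i)"] conjI ballI)
  qed
  then have "\<exists>e. \<forall>\<^sub>F y in nhds w. spectral_decomp d y (\<lambda>i. y \<bullet> e y i) (e y) \<and>
      (\<forall>i\<in>{1..d}. norm (e y i - Q i y) \<le> C i * (norm (y - w))\<^sup>2)"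
    by (subst (asm) eventually_ex) blast
  then obtain e where e: "\<forall>\<^sub>F y in nhds w. spectral_decomp d y (\<lambda>i. y \<bullet> e y i) (e y) \<and>
      (\<forall>i\<in>{1..d}. norm (e y i - Q i y) \<le> C i * (norm (y - w))\<^sup>2)" by blast
  have ew: "e w i = c i" if "i \<in> {1..d}" for i
    using eventually_nhds_x_imp_x[OF e] Qw that by fastforce
  have "\<forall>i\<in>{1..d}. \<exists>D. (Q i has_derivative D) (at w)" using Qd by (auto simp: differentiable_def)
  then obtain D where D: "\<And>i. i \<in> {1..d} \<Longrightarrow> (Q i has_derivative D i) (at w)" by metis
  have eD: "((\<lambda>y. e y i) has_derivative D i) (at w)" if i: "i \<in> {1..d}" for i
    using D[OF i] by (rule has_derivative_quadratic_perturbation)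
      (use e i in \<open>auto elim!: eventually_mono\<close>)
  have lim: "((\<lambda>y. y \<bullet> e y i) \<longlongrightarrow> ev i) (nhds w)" if i: "i \<in> {1..d}" for i
  proof -
    have "isCont (\<lambda>y. e y i) w" using eD[OF i] has_derivative_continuous by blast
    then have "isCont (\<lambda>y. y \<bullet> e y i) w" by (intro continuous_intros)
    then show ?thesis
      using ew[OF i] spectral_coeff[OF s i] by (intro isCont_tendsto_nhds) auto
  qed
  have "\<forall>\<^sub>F y in nhds w. y \<bullet> e y i \<noteq> y \<bullet> e y j" if ij: "i \<in> {1..d}" "j \<in> {1..d}" "i \<noteq> j" for i j
  proof -
    have "((\<lambda>y. y \<bullet> e y i - y \<bullet> e y j) \<longlongrightarrow> ev i - ev j) (nhds w)" by (intro tendsto_diff lim ij)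
    moreover have "ev i - ev j \<noteq> 0" using inj ij by (auto dest: inj_onD)
    ultimately have "\<forall>\<^sub>F y in nhds w. y \<bullet> e y i - y \<bullet> e y j \<noteq> 0" by (rule tendsto_imp_eventually_ne)
    then show ?thesis by eventually_elim simp
  qed
  then have "\<forall>\<^sub>F y in nhds w. \<forall>i\<in>{1..d}. \<forall>j\<in>{1..d} - {i}. y \<bullet> e y i \<noteq> y \<bullet> e y j"
    by (intro eventually_ball_finite ballI) auto
  then have "\<forall>\<^sub>F y in nhds w. inj_on (\<lambda>i. y \<bullet> e y i) {1..d}"
    by eventually_elim (auto intro!: inj_onI)
  with e have "\<forall>\<^sub>F y in nhds w. spectral_decomp d y (\<lambda>i. y \<bullet> e y i) (e y) \<and> inj_on (\<lambda>i. y \<bullet> e y i) {1..d}"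
    by eventually_elim blast
  then show ?thesis using ew eD by blast
qed

section \<open>First derivatives of eigenvalues and frame elements\<close>

lemma has_derivative_unique_eventually:
  assumes "(f has_derivative f') (at x)" "(g has_derivative g') (at x)" "\<forall>\<^sub>F y in nhds x. f y = g y"
  shows "f' a = g' a"
proof -
  have "(g has_derivative f') (at x)"
    using has_derivative_transform_eventually[OF assms(1), of g] assms(3)
      eventually_nhds_x_imp_x[OF assms(3)] by (simp add: eventually_at_filter eventually_mono)
  then show ?thesis using has_derivative_unique[OF _ assms(2)] by metis
qed

lemma frame_sum_delta:
  fixes i n :: nat
  assumes "i \<in> {1..n}"
  shows "(\<Sum>k=1..n. if k = i then f k else 0) = (f i :: 'b::comm_monoid_add)"
  using assms by simp

text \<open>
  Let \<open>D i\<close> and \<open>M i\<close> be the derivatives of the frame elements and of the eigenvalues. Differentiating the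
  relations between them gives \<open>2 c i (D i a) = D i a\<close>, \<open>c i (D j a) + c j (D i a) = 0\<close> and
  \<open>a = \<Sum> (ev k D k a + M k a c k)\<close>, a linear system that determines \<open>D\<close> and \<open>M\<close>. Applying \<open>P (c i)\<close>
  to the last relation annihilates every \<open>D k a\<close> and leaves a multiple of \<open>c i\<close>: the Peirce space of a
  primitive idempotent is one-dimensional.
\<close>

lemma spectral_derivatives:
  fixes w :: "'a::euclidean_jordan_algebra"
  assumes s: "spectral_decomp d w ev c" and inj: "inj_on ev {1..d}"
  shows "\<exists>e :: 'a \<Rightarrow> nat \<Rightarrow> 'a.
    (\<forall>\<^sub>F y in nhds w. spectral_decomp d y (\<lambda>i. y \<bullet> e y i) (e y) \<and> inj_on (\<lambda>i. y \<bullet> e y i) {1..d}) \<and>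
    (\<forall>i\<in>{1..d}. e w i = c i \<and>
       ((\<lambda>y. e y i) has_derivative
          (\<lambda>a. \<Sum>j\<in>{1..d} - {i}. (4 / (ev i - ev j)) *\<^sub>R (c i \<odot> (c j \<odot> a)))) (at w) \<and>
       ((\<lambda>y. y \<bullet> e y i) has_derivative (\<lambda>a. c i \<bullet> a)) (at w) \<and>
       (\<forall>a. jP (c i) a = (c i \<bullet> a) *\<^sub>R c i))"
proof -
  obtain e :: "'a \<Rightarrow> nat \<Rightarrow> 'a" and D where
    ev_e: "\<forall>\<^sub>F y in nhds w. spectral_decomp d y (\<lambda>i. y \<bullet> e y i) (e y) \<and> inj_on (\<lambda>i. y \<bullet> e y i) {1..d}"
    and eD: "\<forall>i\<in>{1..d}. e w i = c i \<and> ((\<lambda>y. e y i) has_derivative D i) (at w)"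
    using spectral_perturbation[OF s inj] by (elim exE conjE)
  have ew: "e w i = c i" and D: "((\<lambda>y. e y i) has_derivative D i) (at w)" if "i \<in> {1..d}" for i
    using eD that by auto
  have fc: "jordan_frame d c" using s by (auto simp: spectral_decomp_def)
  have fe: "\<forall>\<^sub>F y in nhds w. jordan_frame d (e y)"
    and ye: "\<forall>\<^sub>F y in nhds w. y = (\<Sum>i=1..d. (y \<bullet> e y i) *\<^sub>R e y i)"
    using ev_e by (auto elim!: eventually_mono simp: spectral_decomp_def)
  define M where "M i a = w \<bullet> D i a + a \<bullet> c i" for i a
  have M: "((\<lambda>y. y \<bullet> e y i) has_derivative M i) (at w)" if i: "i \<in> {1..d}" for i
    unfolding M_def using has_derivative_inner[OF has_derivative_ident D[OF i]] ew[OF i] by simp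
  have D_half: "2 *\<^sub>R (c i \<odot> D i a) = D i a" if i: "i \<in> {1..d}" for i a
  proof -
    have "\<forall>\<^sub>F y in nhds w. e y i \<odot> e y i = e y i"
      using fe by eventually_elim (rule frame_idem[OF _ i])
    from has_derivative_unique_eventually[OF jprod.FDERIV[OF D[OF i] D[OF i]] D[OF i] this]
    have "c i \<odot> D i a + D i a \<odot> c i = D i a" using ew[OF i] by simp
    then show ?thesis by (simp add: jprod_commute[of "D i a"] scaleR_2)
  qed
  have D_cross: "c i \<odot> D j a = - (c j \<odot> D i a)"
    if i: "i \<in> {1..d}" and j: "j \<in> {1..d}" and ij: "i \<noteq> j" for i j a
  proof -
    have "\<forall>\<^sub>F y in nhds w. e y i \<odot> e y j = 0"
      using fe by eventually_elim (rule frame_orth[OF _ i j ij])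
    from has_derivative_unique_eventually[OF jprod.FDERIV[OF D[OF i] D[OF j]] has_derivative_const this]
    have "c i \<odot> D j a + D i a \<odot> c j = 0" using ew[OF i] ew[OF j] by simp
    then show ?thesis by (simp add: jprod_commute[of "D i a"] eq_neg_iff_add_eq_0)
  qed
  have expand: "a = (\<Sum>k=1..d. ev k *\<^sub>R D k a + M k a *\<^sub>R c k)" for a
  proof -
    have "((\<lambda>y. \<Sum>i=1..d. (y \<bullet> e y i) *\<^sub>R e y i) has_derivative
        (\<lambda>a. \<Sum>k=1..d. (w \<bullet> e w k) *\<^sub>R D k a + M k a *\<^sub>R e w k)) (at w)"
      by (intro has_derivative_sum has_derivative_scaleR M D)
    from has_derivative_unique_eventually[OF has_derivative_ident this ye]
    show ?thesis using ew spectral_coeff[OF s] by simp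
  qed
  have D_far: "c i \<odot> (c j \<odot> D k a) = 0"
    if "i \<in> {1..d}" "j \<in> {1..d}" "k \<in> {1..d}" "i \<noteq> j" "k \<noteq> i" "k \<noteq> j" for i j k a
    using orthogonal_idempotents_triple[of "c i" "c j" "c k" "D k a"] that
      arg_cong[OF D_half[OF that(3), of a], of "\<lambda>x. c i \<odot> (c j \<odot> x)"]
    by (simp add: frame_idem[OF fc] frame_orth[OF fc] jprod.scaleR_right)
  have cross: "4 *\<^sub>R (c i \<odot> (c j \<odot> a)) = (ev i - ev j) *\<^sub>R (2 *\<^sub>R (c j \<odot> D i a))"
    if i: "i \<in> {1..d}" and j: "j \<in> {1..d}" and ij: "i \<noteq> j" for i j a
  proof -
    have comm: "c i \<odot> (c j \<odot> x) = c j \<odot> (c i \<odot> x)" for x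
      using orthogonal_idempotents_commute[of "c i" "c j"] i j ij
      by (simp add: frame_idem[OF fc] frame_orth[OF fc])
    have Di: "4 *\<^sub>R (c i \<odot> (c j \<odot> D i a)) = 2 *\<^sub>R (c j \<odot> D i a)"
      using arg_cong[OF D_half[OF i, of a], of "\<lambda>x. 2 *\<^sub>R (c j \<odot> x)"] comm by (simp add: jprod.scaleR_right)
    have Dj: "4 *\<^sub>R (c i \<odot> (c j \<odot> D j a)) = - 2 *\<^sub>R (c j \<odot> D i a)"
      using arg_cong[OF D_half[OF j, of a], of "\<lambda>x. 2 *\<^sub>R (c i \<odot> x)"] D_cross[OF i j ij, of a]
      by (simp add: jprod.scaleR_right)
    have "4 *\<^sub>R (c i \<odot> (c j \<odot> a)) = (\<Sum>k=1..d. 4 *\<^sub>R (c i \<odot> (c j \<odot> (ev k *\<^sub>R D k a + M k a *\<^sub>R c k))))"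
      by (subst expand) (simp add: jprod.sum_right scaleR_sum_right)
    also have "\<dots> = (\<Sum>k\<in>{1..d}. (if k = i then ev i *\<^sub>R (2 *\<^sub>R (c j \<odot> D i a)) else 0) +
        (if k = j then ev j *\<^sub>R (- 2 *\<^sub>R (c j \<odot> D i a)) else 0))"
    proof (intro sum.cong refl)
      fix k assume k: "k \<in> {1..d}"
      have "c i \<odot> (c j \<odot> c k) = 0"
        using i j k ij by (cases "j = k") (auto simp: frame_idem[OF fc] frame_orth[OF fc] jprod.zero_right)
      then have "4 *\<^sub>R (c i \<odot> (c j \<odot> (ev k *\<^sub>R D k a + M k a *\<^sub>R c k))) =
          ev k *\<^sub>R (4 *\<^sub>R (c i \<odot> (c j \<odot> D k a)))"
        by (simp add: jprod.add_right jprod.scaleR_right)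
      then show "4 *\<^sub>R (c i \<odot> (c j \<odot> (ev k *\<^sub>R D k a + M k a *\<^sub>R c k))) =
          (if k = i then ev i *\<^sub>R (2 *\<^sub>R (c j \<odot> D i a)) else 0) +
          (if k = j then ev j *\<^sub>R (- 2 *\<^sub>R (c j \<odot> D i a)) else 0)"
        using D_far[OF i j k ij, of a] Di Dj ij by (cases "k = i"; cases "k = j") auto
    qed
    also have "\<dots> = (ev i - ev j) *\<^sub>R (2 *\<^sub>R (c j \<odot> D i a))"
      unfolding sum.distrib frame_sum_delta[OF i] frame_sum_delta[OF j]
      by (simp add: scaleR_diff_left)
    finally show ?thesis .
  qed
  have D_eq: "D i a = (\<Sum>j\<in>{1..d} - {i}. (4 / (ev i - ev j)) *\<^sub>R (c i \<odot> (c j \<odot> a)))"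
    if i: "i \<in> {1..d}" for i a
  proof -
    have "(\<Sum>j\<in>{1..d} - {i}. (4 / (ev i - ev j)) *\<^sub>R (c i \<odot> (c j \<odot> a))) =
        (\<Sum>j\<in>{1..d} - {i}. 2 *\<^sub>R (c j \<odot> D i a))"
    proof (intro sum.cong refl)
      fix j assume j: "j \<in> {1..d} - {i}"
      then have ne: "ev i - ev j \<noteq> 0" using inj i by (auto dest: inj_onD)
      have eq: "4 *\<^sub>R (c i \<odot> (c j \<odot> a)) = (ev i - ev j) *\<^sub>R (2 *\<^sub>R (c j \<odot> D i a))"
        using i j by (intro cross) auto
      have "(4 / (ev i - ev j)) *\<^sub>R (c i \<odot> (c j \<odot> a)) =
          inverse (ev i - ev j) *\<^sub>R (4 *\<^sub>R (c i \<odot> (c j \<odot> a)))" by (simp add: divide_inverse)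
      also have "\<dots> = 2 *\<^sub>R (c j \<odot> D i a)"
        by (simp only: eq scaleR_scaleR mult.assoc[symmetric] left_inverse[OF ne] mult_1)
      finally show "(4 / (ev i - ev j)) *\<^sub>R (c i \<odot> (c j \<odot> a)) = 2 *\<^sub>R (c j \<odot> D i a)" .
    qed
    also have "\<dots> = (\<Sum>j=1..d. 2 *\<^sub>R (c j \<odot> D i a)) - 2 *\<^sub>R (c i \<odot> D i a)"
      using i by (simp add: sum_diff1)
    also have "(\<Sum>j=1..d. 2 *\<^sub>R (c j \<odot> D i a)) = 2 *\<^sub>R D i a"
      unfolding scaleR_sum_right[symmetric] jprod.sum_left[symmetric] frame_sum[OF fc] junit_left ..
    finally show ?thesis using D_half[OF i, of a] by (simp add: scaleR_2)
  qed
  have inner_D: "c i \<bullet> D k a = 0" if i: "i \<in> {1..d}" and k: "k \<in> {1..d}" for i k a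
  proof -
    have "c i \<bullet> D k a = 2 * ((c k \<odot> c i) \<bullet> D k a)"
      by (subst D_half[OF k, symmetric]) (simp add: inner_jprod)
    then show ?thesis using i k by (cases "i = k") (auto simp: frame_idem[OF fc] frame_orth[OF fc])
  qed
  have M_eq: "M i a = c i \<bullet> a" if i: "i \<in> {1..d}" for i a
  proof -
    have "c i \<bullet> a = (\<Sum>k=1..d. c i \<bullet> (ev k *\<^sub>R D k a + M k a *\<^sub>R c k))"
      by (subst expand) (simp add: inner_sum_right)
    also have "\<dots> = (\<Sum>k=1..d. if k = i then M k a else 0)"
      using i by (intro sum.cong refl) (auto simp: inner_add_right inner_D frame_inner[OF fc])
    finally show ?thesis using i by simp
  qed
  have jP_c: "jP (c i) x = 2 *\<^sub>R (c i \<odot> (c i \<odot> x)) - c i \<odot> x" if "i \<in> {1..d}" for i x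
    using frame_idem[OF fc that] by (simp add: jP_def jL_def)
  have jP_D: "jP (c i) (D k a) = 0" if i: "i \<in> {1..d}" and k: "k \<in> {1..d}" for i k a
  proof (cases "i = k")
    case True
    have "2 *\<^sub>R (2 *\<^sub>R (c i \<odot> (c i \<odot> D i a))) = 2 *\<^sub>R (c i \<odot> D i a)"
      using arg_cong[OF D_half[OF i, of a], of "\<lambda>x. 2 *\<^sub>R (c i \<odot> x)"] by (simp only: jprod.scaleR_right)
    then have "2 *\<^sub>R (c i \<odot> (c i \<odot> D i a)) = c i \<odot> D i a"
      by (metis scaleR_cancel_left zero_neq_numeral)
    then show ?thesis unfolding True[symmetric] jP_c[OF i] by simp
  next
    case False
    have "2 *\<^sub>R (c i \<odot> (c i \<odot> (c k \<odot> D k a))) = c i \<odot> (c k \<odot> D k a)"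
      using i k False by (intro orthogonal_idempotents_half) (auto simp: frame_idem[OF fc] frame_orth[OF fc])
    then have "jP (c i) (2 *\<^sub>R (c k \<odot> D k a)) = 0"
      by (simp add: jP_c[OF i] jprod.scaleR_right)
    then show ?thesis unfolding D_half[OF k] .
  qed
  have jP_eq: "jP (c i) a = (c i \<bullet> a) *\<^sub>R c i" if i: "i \<in> {1..d}" for i a
  proof -
    have "jP (c i) a = (\<Sum>k=1..d. jP (c i) (ev k *\<^sub>R D k a + M k a *\<^sub>R c k))"
      unfolding jP_c[OF i]
      by (subst (1 2) expand) (simp add: jprod.sum_right scaleR_sum_right sum_subtractf)
    also have "\<dots> = (\<Sum>k=1..d. if k = i then M i a *\<^sub>R c i else 0)"
    proof (intro sum.cong refl)
      fix k assume k: "k \<in> {1..d}"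
      have "jP (c i) (ev k *\<^sub>R D k a + M k a *\<^sub>R c k) = ev k *\<^sub>R jP (c i) (D k a) + M k a *\<^sub>R jP (c i) (c k)"
        unfolding jP_c[OF i] by (simp add: jprod.add_right jprod.scaleR_right algebra_simps)
      moreover have "jP (c i) (c k) = (if k = i then c i else 0)"
        using i k by (auto simp: jP_c frame_idem[OF fc] frame_orth[OF fc] jprod.zero_right scaleR_2)
      ultimately show "jP (c i) (ev k *\<^sub>R D k a + M k a *\<^sub>R c k) = (if k = i then M i a *\<^sub>R c i else 0)"
        using jP_D[OF i k] by simp
    qed
    finally show ?thesis using i M_eq[OF i] by simp
  qed
  have "((\<lambda>y. e y i) has_derivative
          (\<lambda>a. \<Sum>j\<in>{1..d} - {i}. (4 / (ev i - ev j)) *\<^sub>R (c i \<odot> (c j \<odot> a)))) (at w)"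
    if i: "i \<in> {1..d}" for i
    using D[OF i] unfolding D_eq[OF i, abs_def] .
  moreover have "((\<lambda>y. y \<bullet> e y i) has_derivative (\<lambda>a. c i \<bullet> a)) (at w)" if i: "i \<in> {1..d}" for i
    using M[OF i] unfolding M_eq[OF i, abs_def] .
  ultimately show ?thesis using ev_e ew jP_eq by (intro exI[of _ e]) blast
qed

text \<open>
  Every frame occurs in \<open>spectral_derivatives\<close>, with the eigenvalues \<open>1, \<dots>, d\<close>.
\<close>

lemma frame_jP:
  fixes c :: "nat \<Rightarrow> 'a::euclidean_jordan_algebra"
  assumes "jordan_frame d c" "i \<in> {1..d}"
  shows "jP (c i) a = (c i \<bullet> a) *\<^sub>R c i"
proof -
  have "spectral_decomp d (\<Sum>i=1..d. real i *\<^sub>R c i) real c"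
    using assms(1) by (simp add: spectral_decomp_def)
  from spectral_derivatives[OF this inj_on_of_nat] show ?thesis using assms(2) by blast
qed

section \<open>Peirce multipliers and derivatives of spectral functions\<close>

definition strict_pairs :: "nat \<Rightarrow> (nat \<times> nat) set" where
  "strict_pairs d = {(i, j). 1 \<le> i \<and> i < j \<and> j \<le> d}"

definition weak_pairs :: "nat \<Rightarrow> (nat \<times> nat) set" where
  "weak_pairs d = {(i, j). 1 \<le> i \<and> i \<le> j \<and> j \<le> d}"

lemma finite_strict_pairs [simp]: "finite (strict_pairs d)"
  by (rule finite_subset[of _ "{1..d} \<times> {1..d}"]) (auto simp: strict_pairs_def)

lemma finite_weak_pairs [simp]: "finite (weak_pairs d)"
  by (rule finite_subset[of _ "{1..d} \<times> {1..d}"]) (auto simp: weak_pairs_def)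

lemma sum_weak_pairs:
  fixes f :: "nat \<times> nat \<Rightarrow> 'b::comm_monoid_add"
  shows "(\<Sum>a\<in>weak_pairs d. f a) = (\<Sum>i=1..d. f (i, i)) + (\<Sum>a\<in>strict_pairs d. f a)"
proof -
  have "weak_pairs d = (\<lambda>i. (i, i)) ` {1..d} \<union> strict_pairs d"
    by (auto simp: weak_pairs_def strict_pairs_def)
  moreover have "(\<lambda>i. (i, i)) ` {1..d} \<inter> strict_pairs d = {}" by (auto simp: strict_pairs_def)
  ultimately show ?thesis
    by (simp add: sum.union_disjoint sum.reindex inj_on_def)
qed

lemma sum_off_diagonal:
  fixes F :: "nat \<Rightarrow> nat \<Rightarrow> 'b::comm_monoid_add"
  shows "(\<Sum>i=1..d. \<Sum>j\<in>{1..d} - {i}. F i j) = (\<Sum>(i, j)\<in>strict_pairs d. F i j + F j i)"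
proof -
  have "(\<Sum>i=1..d. \<Sum>j\<in>{1..d} - {i}. F i j) = (\<Sum>(i, j)\<in>Sigma {1..d} (\<lambda>i. {1..d} - {i}). F i j)"
    by (rule sum.Sigma) auto
  also have "Sigma {1..d} (\<lambda>i. {1..d} - {i}) = strict_pairs d \<union> prod.swap ` strict_pairs d"
    by (auto simp: strict_pairs_def image_iff)
  also have "(\<Sum>(i, j)\<in>\<dots>. F i j) =
      (\<Sum>(i, j)\<in>strict_pairs d. F i j) + (\<Sum>(i, j)\<in>prod.swap ` strict_pairs d. F i j)"
    by (rule sum.union_disjoint) (simp, simp, auto simp: strict_pairs_def)
  also have "(\<Sum>(i, j)\<in>prod.swap ` strict_pairs d. F i j) = (\<Sum>(i, j)\<in>strict_pairs d. F j i)"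
    by (subst sum.reindex) (auto simp: case_prod_unfold)
  finally show ?thesis by (simp add: sum.distrib[symmetric] case_prod_unfold)
qed

definition peirce :: "(nat \<Rightarrow> 'a::euclidean_jordan_algebra) \<Rightarrow> nat \<times> nat \<Rightarrow> 'a \<Rightarrow> 'a" where
  "peirce c a x = (if fst a = snd a then jP (c (fst a)) x
                   else 4 *\<^sub>R (c (fst a) \<odot> (c (snd a) \<odot> x)))"

text \<open>
  The operator \<open>M\<close> of the theorem, its inverse, and the derivatives of \<open>x \<mapsto> g(x)\<close> are all of this form.
  Only the entries \<open>m i j\<close> with \<open>i \<le> j\<close> matter.
\<close>

definition peirce_mult ::
  "nat \<Rightarrow> (nat \<Rightarrow> 'a::euclidean_jordan_algebra) \<Rightarrow> (nat \<Rightarrow> nat \<Rightarrow> real) \<Rightarrow> 'a \<Rightarrow> 'a" where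
  "peirce_mult d c m x = (\<Sum>a\<in>weak_pairs d. m (fst a) (snd a) *\<^sub>R peirce c a x)"

lemma weak_pairsD: "a \<in> weak_pairs d \<Longrightarrow> fst a \<in> {1..d} \<and> snd a \<in> {1..d} \<and> fst a \<le> snd a"
  by (auto simp: weak_pairs_def)

lemma linear_peirce: "linear (peirce c a)"
  by (rule linearI) (auto simp: peirce_def jP_def jL_def jprod.add_right jprod.scaleR_right algebra_simps)

lemma linear_peirce_mult: "linear (peirce_mult d c m)"
  unfolding peirce_mult_def by (intro linear_compose_sum ballI linear_compose_scale_right linear_peirce)

lemma frame_commute:
  fixes c :: "nat \<Rightarrow> 'a::euclidean_jordan_algebra"
  assumes "jordan_frame d c" "i \<in> {1..d}" "j \<in> {1..d}"
  shows "c i \<odot> (c j \<odot> x) = c j \<odot> (c i \<odot> x)"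
  using orthogonal_idempotents_commute[of "c i" "c j" x] assms
  by (cases "i = j") (auto simp: frame_idem frame_orth)

lemma frame_triple:
  fixes c :: "nat \<Rightarrow> 'a::euclidean_jordan_algebra"
  assumes "jordan_frame d c" "i \<in> {1..d}" "j \<in> {1..d}" "k \<in> {1..d}" "i \<noteq> j" "i \<noteq> k" "j \<noteq> k"
  shows "c i \<odot> (c j \<odot> (c k \<odot> x)) = 0"
  using assms by (intro orthogonal_idempotents_triple) (auto simp: frame_idem frame_orth)

lemma peirce_compose:
  fixes c :: "nat \<Rightarrow> 'a::euclidean_jordan_algebra"
  assumes fc: "jordan_frame d c" and a: "a \<in> weak_pairs d" and b: "b \<in> weak_pairs d"
  shows "peirce c a (peirce c b x) = (if a = b then peirce c a x else 0)"
proof -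
  obtain i j k l where ab: "a = (i, j)" "b = (k, l)" by (cases a, cases b)
  have i: "i \<in> {1..d}" and j: "j \<in> {1..d}" and k: "k \<in> {1..d}" and l: "l \<in> {1..d}"
    and ij: "i \<le> j" and kl: "k \<le> l" using weak_pairsD[OF a] weak_pairsD[OF b] ab by auto
  consider "i = j" "k = l" | "i = j" "k \<noteq> l" | "i \<noteq> j" "k = l" | "i \<noteq> j" "k \<noteq> l" by blast
  then show ?thesis
  proof cases
    case 1
    have "jP (c i) (jP (c k) x) = (if i = k then jP (c i) x else 0)"
      unfolding frame_jP[OF fc i] frame_jP[OF fc k] inner_scaleR_right frame_inner[OF fc i k] by simp
    then show ?thesis using 1 by (simp add: ab peirce_def)
  next
    case 2
    have "c i \<bullet> (c k \<odot> (c l \<odot> x)) = 0"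
    proof (cases "i = k")
      case True
      have "c k \<bullet> (c k \<odot> (c l \<odot> x)) = c k \<bullet> (c l \<odot> x)"
        using inner_jprod[of "c k" "c k" "c l \<odot> x"] by (simp add: frame_idem[OF fc k])
      also have "\<dots> = (c l \<odot> c k) \<bullet> x" by (simp add: inner_jprod)
      finally show ?thesis using True 2 frame_orth[OF fc l k] by simp
    next
      case False
      have "c i \<bullet> (c k \<odot> (c l \<odot> x)) = (c k \<odot> c i) \<bullet> (c l \<odot> x)" by (simp add: inner_jprod)
      then show ?thesis using False frame_orth[OF fc k i] by simp
    qed
    then have "jP (c i) (4 *\<^sub>R (c k \<odot> (c l \<odot> x))) = 0"
      unfolding frame_jP[OF fc i] by simp
    then show ?thesis using 2 by (auto simp: ab peirce_def)
  next
    case 3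
    have "c i \<odot> (c j \<odot> c k) = 0"
      using 3 frame_orth[OF fc i j] frame_orth[OF fc j k] frame_idem[OF fc j]
      by (cases "j = k") (auto simp: jprod.zero_right)
    then have "4 *\<^sub>R (c i \<odot> (c j \<odot> jP (c k) x)) = 0"
      unfolding frame_jP[OF fc k] by (simp add: jprod.scaleR_right)
    then show ?thesis using 3 by (auto simp: ab peirce_def)
  next
    case 4
    have e: "peirce c a (peirce c b x) = 16 *\<^sub>R (c i \<odot> (c j \<odot> (c k \<odot> (c l \<odot> x))))"
      using 4 by (simp add: ab peirce_def jprod.scaleR_right)
    consider "i \<noteq> k" "i \<noteq> l" | "j \<noteq> k" "j \<noteq> l" | "i = k" "j = l"
      using 4 ij kl by linarith
    then show ?thesis
    proof cases
      case 1
      then show ?thesis using 4 e frame_commute[OF fc i j] frame_triple[OF fc i k l]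
        by (auto simp: ab jprod.zero_right)
    next
      case 2
      then show ?thesis using 4 e frame_triple[OF fc j k l]
        by (auto simp: ab jprod.zero_right)
    next
      case 3
      have h: "2 *\<^sub>R (c p \<odot> (c p \<odot> (c q \<odot> y))) = c p \<odot> (c q \<odot> y)"
        if "p \<in> {1..d}" "q \<in> {1..d}" "p \<noteq> q" for p q y
        using that by (intro orthogonal_idempotents_half) (auto simp: frame_idem[OF fc] frame_orth[OF fc])
      have "16 *\<^sub>R (c i \<odot> (c j \<odot> (c i \<odot> (c j \<odot> x)))) = 8 *\<^sub>R (2 *\<^sub>R (c i \<odot> (c i \<odot> (c j \<odot> (c j \<odot> x)))))"
        using frame_commute[OF fc i j] by simp
      also have "\<dots> = 8 *\<^sub>R (c j \<odot> (c j \<odot> (c i \<odot> x)))"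
        unfolding h[OF i j 4(1)] using frame_commute[OF fc i j] by simp
      also have "\<dots> = 4 *\<^sub>R (2 *\<^sub>R (c j \<odot> (c j \<odot> (c i \<odot> x))))" by simp
      also have "\<dots> = 4 *\<^sub>R (c i \<odot> (c j \<odot> x))"
        using 4 frame_commute[OF fc i j] by (subst h[OF j i]) auto
      finally show ?thesis using 3 4 e by (simp add: ab peirce_def)
    qed
  qed
qed

text \<open>
  Since the unit is the sum of the frame, this is the expansion of \<open>2 e (e x) - e x = x\<close>.
\<close>

lemma peirce_sum:
  fixes c :: "nat \<Rightarrow> 'a::euclidean_jordan_algebra"
  assumes fc: "jordan_frame d c"
  shows "(\<Sum>a\<in>weak_pairs d. peirce c a x) = x"
proof -
  have one: "(\<Sum>i=1..d. c i \<odot> y) = y" for y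
    unfolding jprod.sum_left[symmetric] frame_sum[OF fc] junit_left ..
  have "x = (\<Sum>i=1..d. \<Sum>j=1..d. c i \<odot> (c j \<odot> x))"
    by (simp add: jprod.sum_right[symmetric] one)
  also have "\<dots> = (\<Sum>i=1..d. c i \<odot> (c i \<odot> x)) + (\<Sum>i=1..d. \<Sum>j\<in>{1..d} - {i}. c i \<odot> (c j \<odot> x))"
    unfolding sum.distrib[symmetric] by (intro sum.cong refl) (simp add: sum.remove)
  also have "(\<Sum>i=1..d. \<Sum>j\<in>{1..d} - {i}. c i \<odot> (c j \<odot> x)) =
      (\<Sum>(i, j)\<in>strict_pairs d. 2 *\<^sub>R (c i \<odot> (c j \<odot> x)))"
    unfolding sum_off_diagonal
    by (intro sum.cong refl)
      (auto simp: strict_pairs_def scaleR_2 intro!: frame_commute[OF fc])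
  finally have x: "x = (\<Sum>i=1..d. c i \<odot> (c i \<odot> x)) + (\<Sum>(i, j)\<in>strict_pairs d. 2 *\<^sub>R (c i \<odot> (c j \<odot> x)))" .
  have "(\<Sum>a\<in>weak_pairs d. peirce c a x) = (\<Sum>i=1..d. 2 *\<^sub>R (c i \<odot> (c i \<odot> x)) - c i \<odot> x)
      + (\<Sum>(i, j)\<in>strict_pairs d. 2 *\<^sub>R (2 *\<^sub>R (c i \<odot> (c j \<odot> x))))"
    unfolding sum_weak_pairs
    by (intro arg_cong2[where f = "(+)"] sum.cong refl)
      (auto simp: peirce_def jP_def jL_def frame_idem[OF fc] strict_pairs_def)
  also have "\<dots> = 2 *\<^sub>R ((\<Sum>i=1..d. c i \<odot> (c i \<odot> x)) + (\<Sum>(i, j)\<in>strict_pairs d. 2 *\<^sub>R (c i \<odot> (c j \<odot> x)))) - x"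
    by (simp add: sum_subtractf one scaleR_add_right scaleR_sum_right case_prod_unfold)
  also have "\<dots> = x" unfolding x[symmetric] by (simp add: scaleR_2)
  finally show ?thesis .
qed

lemma peirce_selfadjoint:
  fixes c :: "nat \<Rightarrow> 'a::euclidean_jordan_algebra"
  assumes fc: "jordan_frame d c" and a: "a \<in> weak_pairs d"
  shows "peirce c a x \<bullet> y = x \<bullet> peirce c a y"
proof (cases "fst a = snd a")
  case True
  then show ?thesis using frame_jP[OF fc] weak_pairsD[OF a] by (simp add: peirce_def inner_commute)
next
  case False
  have "c (fst a) \<odot> (c (snd a) \<odot> y) = c (snd a) \<odot> (c (fst a) \<odot> y)"
    using frame_commute[OF fc] weak_pairsD[OF a] by blast
  then show ?thesis using False by (simp add: peirce_def inner_jprod)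
qed

lemma peirce_mult_selfadjoint:
  fixes c :: "nat \<Rightarrow> 'a::euclidean_jordan_algebra"
  assumes fc: "jordan_frame d c"
  shows "peirce_mult d c m x \<bullet> y = x \<bullet> peirce_mult d c m y"
  unfolding peirce_mult_def inner_sum_left inner_sum_right
  by (intro sum.cong refl) (simp add: peirce_selfadjoint[OF fc])

lemma peirce_mult_compose:
  fixes c :: "nat \<Rightarrow> 'a::euclidean_jordan_algebra"
  assumes fc: "jordan_frame d c"
  shows "peirce_mult d c m (peirce_mult d c m' x) = peirce_mult d c (\<lambda>i j. m i j * m' i j) x"
proof -
  have "peirce c a (\<Sum>b\<in>weak_pairs d. m' (fst b) (snd b) *\<^sub>R peirce c b x) =
      m' (fst a) (snd a) *\<^sub>R peirce c a x" if a: "a \<in> weak_pairs d" for a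
  proof -
    have "peirce c a (\<Sum>b\<in>weak_pairs d. m' (fst b) (snd b) *\<^sub>R peirce c b x) =
      (\<Sum>b\<in>weak_pairs d. m' (fst b) (snd b) *\<^sub>R peirce c a (peirce c b x))"
      by (simp add: linear_sum[OF linear_peirce] linear_cmul[OF linear_peirce])
    also have "\<dots> = (\<Sum>b\<in>weak_pairs d. if b = a then m' (fst a) (snd a) *\<^sub>R peirce c a x else 0)"
      using peirce_compose[OF fc a] by (intro sum.cong refl) auto
    finally show ?thesis using a by simp
  qed
  then show ?thesis unfolding peirce_mult_def by (intro sum.cong refl) simp
qed

lemma peirce_mult_one:
  assumes fc: "jordan_frame d c" and m: "\<And>i j. i \<in> {1..d} \<Longrightarrow> j \<in> {1..d} \<Longrightarrow> i \<le> j \<Longrightarrow> m i j = 1"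
  shows "peirce_mult d c m x = x"
proof -
  have "peirce_mult d c m x = (\<Sum>a\<in>weak_pairs d. peirce c a x)"
    unfolding peirce_mult_def using weak_pairsD m by (intro sum.cong refl) (metis scaleR_one)
  then show ?thesis using peirce_sum[OF fc] by simp
qed

lemma peirce_mult_cong:
  assumes "\<And>i j. i \<in> {1..d} \<Longrightarrow> j \<in> {1..d} \<Longrightarrow> i \<le> j \<Longrightarrow> m i j = m' i j"
  shows "peirce_mult d c m x = peirce_mult d c m' x"
  unfolding peirce_mult_def using weak_pairsD assms by (intro sum.cong refl) metis

lemma peirce_mult_add:
  "peirce_mult d c m x + peirce_mult d c m' x = peirce_mult d c (\<lambda>i j. m i j + m' i j) x"
  unfolding peirce_mult_def by (simp add: sum.distrib scaleR_add_left)

lemma peirce_mult_scale: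
  "t *\<^sub>R peirce_mult d c m x = peirce_mult d c (\<lambda>i j. t * m i j) x"
  unfolding peirce_mult_def by (simp add: scaleR_sum_right)

lemma peirce_mult_frame:
  fixes c :: "nat \<Rightarrow> 'a::euclidean_jordan_algebra"
  assumes fc: "jordan_frame d c"
  shows "peirce_mult d c m (\<Sum>i=1..d. t i *\<^sub>R c i) = (\<Sum>i=1..d. (m i i * t i) *\<^sub>R c i)"
proof -
  have "peirce_mult d c m (c k) = m k k *\<^sub>R c k" if k: "k \<in> {1..d}" for k
  proof -
    have off: "peirce c a (c k) = 0" if a: "a \<in> strict_pairs d" for a
    proof -
      obtain i j where ij: "a = (i, j)" "i \<in> {1..d}" "j \<in> {1..d}" "i \<noteq> j"
        using a by (auto simp: strict_pairs_def)
      then show ?thesis using frame_orth[OF fc ij(2,3)] frame_orth[OF fc ij(3) k] frame_idem[OF fc k]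
        by (cases "j = k") (auto simp: peirce_def jprod.zero_right)
    qed
    have "(\<Sum>i=1..d. m i i *\<^sub>R peirce c (i, i) (c k)) = (\<Sum>i=1..d. if i = k then m k k *\<^sub>R c k else 0)"
      by (intro sum.cong refl) (simp add: peirce_def frame_jP[OF fc] frame_inner[OF fc _ k])
    then have "peirce_mult d c m (c k) = (\<Sum>i=1..d. if i = k then m k k *\<^sub>R c k else 0)"
      unfolding peirce_mult_def sum_weak_pairs by (simp add: off)
    then show ?thesis using k by simp
  qed
  then show ?thesis
    by (simp add: linear_sum[OF linear_peirce_mult] linear_cmul[OF linear_peirce_mult] mult.commute)
qed

text \<open>
  In \<open>g(y) = \<Sum> g (\<mu> i) e i\<close> the eigenvalues contribute \<open>g'\<close> on the diagonal, while the derivatives of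
  \<open>e i\<close> and \<open>e j\<close> contribute the multiples \<open>g (ev i) / (ev i - ev j)\<close> and \<open>g (ev j) / (ev j - ev i)\<close> of
  the same Peirce component, which add up to a divided difference.
\<close>

lemma jfun_has_derivative:
  fixes w :: "'a::euclidean_jordan_algebra"
  assumes s: "spectral_decomp d w ev c" and inj: "inj_on ev {1..d}"
    and g: "\<And>i. i \<in> {1..d} \<Longrightarrow> (g has_real_derivative g' i) (at (ev i))"
  shows "(jfun g has_derivative peirce_mult d c
      (\<lambda>i j. if i = j then g' i else (g (ev i) - g (ev j)) / (ev i - ev j))) (at w)"
proof -
  define dd where "dd i j = (if i = j then g' i else (g (ev i) - g (ev j)) / (ev i - ev j))" for i j
  obtain e :: "'a \<Rightarrow> nat \<Rightarrow> 'a" where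
    ev_e: "\<forall>\<^sub>F y in nhds w. spectral_decomp d y (\<lambda>i. y \<bullet> e y i) (e y) \<and> inj_on (\<lambda>i. y \<bullet> e y i) {1..d}"
    and e: "\<forall>i\<in>{1..d}. e w i = c i \<and>
       ((\<lambda>y. e y i) has_derivative
          (\<lambda>a. \<Sum>j\<in>{1..d} - {i}. (4 / (ev i - ev j)) *\<^sub>R (c i \<odot> (c j \<odot> a)))) (at w) \<and>
       ((\<lambda>y. y \<bullet> e y i) has_derivative (\<lambda>a. c i \<bullet> a)) (at w) \<and>
       (\<forall>a. jP (c i) a = (c i \<bullet> a) *\<^sub>R c i)"
    using spectral_derivatives[OF s inj] by (elim exE conjE)
  have fc: "jordan_frame d c" using s by (auto simp: spectral_decomp_def)
  define E where "E i a = (\<Sum>j\<in>{1..d} - {i}. (4 / (ev i - ev j)) *\<^sub>R (c i \<odot> (c j \<odot> a)))" for i a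
  have jf: "\<forall>\<^sub>F y in nhds w. (\<Sum>i=1..d. g (y \<bullet> e y i) *\<^sub>R e y i) = jfun g y"
    using ev_e
  proof eventually_elim
    case (elim y)
    show ?case using jfun_distinct[OF elim[THEN conjunct1] elim[THEN conjunct2], of g] by simp
  qed
  have ewi: "e w i = c i" "w \<bullet> c i = ev i" if "i \<in> {1..d}" for i
    using e spectral_coeff[OF s] that by auto
  have d: "((\<lambda>y. g (y \<bullet> e y i) *\<^sub>R e y i) has_derivative
      (\<lambda>a. g (ev i) *\<^sub>R E i a + (g' i * (c i \<bullet> a)) *\<^sub>R c i)) (at w)" if i: "i \<in> {1..d}" for i
  proof -
    have "((\<lambda>y. g (y \<bullet> e y i)) has_derivative (\<lambda>a. g' i * (c i \<bullet> a))) (at w)"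
      using has_derivative_compose[of "\<lambda>y. y \<bullet> e y i" "\<lambda>a. c i \<bullet> a" w UNIV g "(*) (g' i)"]
        e g[OF i] i ewi[OF i] by (simp add: has_field_derivative_def)
    moreover have "((\<lambda>y. e y i) has_derivative E i) (at w)" using e i by (simp add: E_def[abs_def])
    ultimately show ?thesis
      using has_derivative_scaleR[of "\<lambda>y. g (y \<bullet> e y i)" _ w UNIV "\<lambda>y. e y i" "E i"] ewi[OF i] by simp
  qed
  have "((\<lambda>y. \<Sum>i=1..d. g (y \<bullet> e y i) *\<^sub>R e y i) has_derivative
      (\<lambda>a. \<Sum>i=1..d. g (ev i) *\<^sub>R E i a + (g' i * (c i \<bullet> a)) *\<^sub>R c i)) (at w)"
    by (intro has_derivative_sum d)
  moreover have "(\<Sum>i=1..d. g (ev i) *\<^sub>R E i a + (g' i * (c i \<bullet> a)) *\<^sub>R c i) = peirce_mult d c dd a" for a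
  proof -
    have "(\<Sum>i=1..d. g (ev i) *\<^sub>R E i a) = (\<Sum>(i, j)\<in>strict_pairs d.
        (g (ev i) * (4 / (ev i - ev j))) *\<^sub>R (c i \<odot> (c j \<odot> a)) +
        (g (ev j) * (4 / (ev j - ev i))) *\<^sub>R (c j \<odot> (c i \<odot> a)))"
      unfolding E_def scaleR_sum_right scaleR_scaleR by (rule sum_off_diagonal)
    also have "\<dots> = (\<Sum>p\<in>strict_pairs d. dd (fst p) (snd p) *\<^sub>R peirce c p a)"
    proof (intro sum.cong refl)
      fix p assume "p \<in> strict_pairs d"
      then obtain i j where p: "p = (i, j)" "i \<in> {1..d}" "j \<in> {1..d}" "i < j"
        by (auto simp: strict_pairs_def)
      have ne: "ev i \<noteq> ev j" using inj p by (auto dest: inj_onD)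
      have "g (ev i) * (4 / (ev i - ev j)) + g (ev j) * (4 / (ev j - ev i)) =
          (g (ev i) - g (ev j)) / (ev i - ev j) * 4"
        using ne by (simp add: divide_simps) (simp add: algebra_simps)
      then show "(case p of (i, j) \<Rightarrow>
        (g (ev i) * (4 / (ev i - ev j))) *\<^sub>R (c i \<odot> (c j \<odot> a)) +
        (g (ev j) * (4 / (ev j - ev i))) *\<^sub>R (c j \<odot> (c i \<odot> a))) = dd (fst p) (snd p) *\<^sub>R peirce c p a"
        using p frame_commute[OF fc p(3,2), of a]
        by (simp add: dd_def peirce_def scaleR_add_left[symmetric])
    qed
    moreover have "(\<Sum>i=1..d. (g' i * (c i \<bullet> a)) *\<^sub>R c i) = (\<Sum>i=1..d. dd i i *\<^sub>R peirce c (i, i) a)"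
      using frame_jP[OF fc] by (intro sum.cong refl) (simp add: dd_def peirce_def)
    ultimately show ?thesis
      unfolding peirce_mult_def sum_weak_pairs by (simp add: sum.distrib)
  qed
  ultimately have "((\<lambda>y. \<Sum>i=1..d. g (y \<bullet> e y i) *\<^sub>R e y i) has_derivative peirce_mult d c dd) (at w)"
    by (simp add: fun_eq_iff[symmetric])
  then have "(jfun g has_derivative peirce_mult d c dd) (at w)"
    by (rule has_derivative_transform_eventually)
      (use jf eventually_nhds_x_imp_x[OF jf] in \<open>auto simp: eventually_at_filter elim: eventually_mono\<close>)
  then show ?thesis by (simp add: dd_def[abs_def])
qed

text \<open>
  The trace is the inner product with the unit. A multiplier is self-adjoint and maps the unit to its
  diagonal, so the off-diagonal part of the derivative of \<open>g(x)\<close> has trace \<open>0\<close>.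
\<close>

lemma spectral_fun_has_derivative:
  fixes w :: "'a::euclidean_jordan_algebra"
  assumes s: "spectral_decomp d w ev c" and inj: "inj_on ev {1..d}"
    and g: "\<And>i. i \<in> {1..d} \<Longrightarrow> (g has_real_derivative g' i) (at (ev i))"
  shows "(spectral_fun g has_derivative (\<lambda>a. (\<Sum>i=1..d. g' i *\<^sub>R c i) \<bullet> a)) (at w)"
proof -
  have fc: "jordan_frame d c" using s by (auto simp: spectral_decomp_def)
  let ?dd = "\<lambda>i j. if i = j then g' i else (g (ev i) - g (ev j)) / (ev i - ev j)"
  have "((\<lambda>y. junit \<bullet> jfun g y) has_derivative (\<lambda>a. junit \<bullet> peirce_mult d c ?dd a)) (at w)"
    by (intro has_derivative_inner_right jfun_has_derivative[OF s inj g])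
  moreover have "junit \<bullet> peirce_mult d c ?dd a = (\<Sum>i=1..d. g' i *\<^sub>R c i) \<bullet> a" for a
    using peirce_mult_frame[OF fc, of ?dd "\<lambda>_. 1"]
    by (simp add: peirce_mult_selfadjoint[OF fc, symmetric] frame_sum[OF fc])
  moreover have "spectral_fun g = (\<lambda>y :: 'a. junit \<bullet> jfun g y)"
    by (simp add: spectral_fun_def[abs_def] jtrace_eq_inner)
  ultimately show ?thesis by simp
qed

text \<open>
  The open set on which \<open>\<Gamma>\<close> is differentiated; it is stable under positive scaling, so it contains
  \<open>w\<close> and \<open>v\<^sup>-\<^sup>1 w\<close> at the same time.
\<close>

definition positive_regular :: "'a::euclidean_jordan_algebra set" where
  "positive_regular = {w. \<exists>d ev c. spectral_decomp d w ev c \<and> inj_on ev {1..d} \<and> (\<forall>i\<in>{1..d}. ev i > 0)}"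

lemma positive_regular_nhds:
  fixes w :: "'a::euclidean_jordan_algebra"
  assumes "w \<in> positive_regular"
  shows "\<forall>\<^sub>F y in nhds w. y \<in> positive_regular"
proof -
  obtain d ev c where s: "spectral_decomp d w ev c" and inj: "inj_on ev {1..d}"
    and pos: "\<forall>i\<in>{1..d}. ev i > 0" using assms by (auto simp: positive_regular_def)
  obtain e :: "'a \<Rightarrow> nat \<Rightarrow> 'a" and D where
    ev_e: "\<forall>\<^sub>F y in nhds w. spectral_decomp d y (\<lambda>i. y \<bullet> e y i) (e y) \<and> inj_on (\<lambda>i. y \<bullet> e y i) {1..d}"
    and eD: "\<forall>i\<in>{1..d}. e w i = c i \<and> ((\<lambda>y. e y i) has_derivative D i) (at w)"
    using spectral_perturbation[OF s inj] by (elim exE conjE)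
  have "\<forall>\<^sub>F y in nhds w. y \<bullet> e y i > 0" if i: "i \<in> {1..d}" for i
  proof -
    have "isCont (\<lambda>y. e y i) w" using eD i has_derivative_continuous by blast
    then have "isCont (\<lambda>y. y \<bullet> e y i) w" by (intro continuous_intros)
    then have "((\<lambda>y. y \<bullet> e y i) \<longlongrightarrow> ev i) (nhds w)"
      using eD i spectral_coeff[OF s i] by (intro isCont_tendsto_nhds) auto
    then show ?thesis using pos i order_tendstoD(1) by blast
  qed
  then have "\<forall>\<^sub>F y in nhds w. \<forall>i\<in>{1..d}. y \<bullet> e y i > 0" by (intro eventually_ball_finite) auto
  with ev_e show ?thesis unfolding positive_regular_def by eventually_elim blast
qed

text \<open>
  The logarithm of the determinant is the spectral function of \<open>ln\<close>.
\<close>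

lemma ln_jdet_has_derivative:
  fixes w :: "'a::euclidean_jordan_algebra"
  assumes "w \<in> positive_regular"
  shows "((\<lambda>y. ln (jdet y)) has_derivative (\<lambda>a. jinv w \<bullet> a)) (at w)"
proof -
  obtain d ev c where s: "spectral_decomp d w ev c" and inj: "inj_on ev {1..d}"
    and pos: "\<forall>i\<in>{1..d}. ev i > 0" using assms by (auto simp: positive_regular_def)
  have "ln (jdet y) = spectral_fun ln y" if "y \<in> positive_regular" for y :: 'a
  proof -
    obtain n mu e where t: "spectral_decomp n y mu e" "inj_on mu {1..n}" "\<forall>i\<in>{1..n}. mu i > 0"
      using \<open>y \<in> positive_regular\<close> by (auto simp: positive_regular_def)
    have fe: "jordan_frame n e" using t by (auto simp: spectral_decomp_def)
    have "ln (\<Prod>i=1..n. mu i) = (\<Sum>i=1..n. ln (mu i))"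
      using t(3) by (intro ln_prod) force+
    then show ?thesis
      unfolding jdet_distinct[OF t(1,2)] spectral_fun_def jfun_distinct[OF t(1,2)]
      by (simp add: jtrace_eq_inner inner_sum_right frame_trace[OF fe])
  qed
  then have eq: "\<forall>\<^sub>F y in nhds w. spectral_fun ln y = ln (jdet y)"
    using positive_regular_nhds[OF assms] by (auto elim: eventually_mono)
  have "(spectral_fun ln has_derivative (\<lambda>a. (\<Sum>i=1..d. inverse (ev i) *\<^sub>R c i) \<bullet> a)) (at w)"
    using pos by (intro spectral_fun_has_derivative[OF s inj]) (auto intro!: derivative_eq_intros simp: divide_inverse)
  then show ?thesis
    unfolding jinv_def jfun_distinct[OF s inj]
    by (rule has_derivative_transform_eventually)
      (use eq eventually_nhds_x_imp_x[OF eq] in \<open>auto simp: eventually_at_filter elim: eventually_mono\<close>)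
qed

section \<open>Gradient and Hessian of the barrier\<close>

lemma second_dir_deriv_eq:
  fixes f :: "'a::euclidean_space \<Rightarrow> real"
  assumes f: "\<forall>\<^sub>F y in nhds x. (f has_derivative (\<lambda>a. N y \<bullet> a)) (at y)"
    and N: "(N has_derivative H) (at x)"
  shows "second_dir_deriv f x a b = H a \<bullet> b"
proof -
  interpret H: bounded_linear H using N by (rule has_derivative_bounded_linear)
  have line: "((\<lambda>s. y + s *\<^sub>R a) has_derivative (\<lambda>s. s *\<^sub>R a)) (at t)" for y a :: 'a and t :: real
    by (auto intro!: derivative_eq_intros)
  have inner: "deriv (\<lambda>t. f (y + t *\<^sub>R b)) 0 = N y \<bullet> b"
    if "(f has_derivative (\<lambda>a. N y \<bullet> a)) (at y)" for y
  proof -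
    have f0: "(f has_derivative (\<lambda>a. N y \<bullet> a)) (at (y + 0 *\<^sub>R b))" using that by simp
    from has_derivative_compose[OF line f0] have "((\<lambda>t. f (y + t *\<^sub>R b)) has_real_derivative N y \<bullet> b) (at 0)"
      by (simp add: has_field_derivative_def mult.commute[of _ "N y \<bullet> b"])
    then show ?thesis by (rule DERIV_imp_deriv)
  qed
  have "((\<lambda>s. x + s *\<^sub>R a) \<longlongrightarrow> x) (nhds 0)"
    by (rule isCont_tendsto_nhds) (auto intro!: continuous_intros)
  then have "\<forall>\<^sub>F s in nhds 0. (f has_derivative (\<lambda>b. N (x + s *\<^sub>R a) \<bullet> b)) (at (x + s *\<^sub>R a))"
    using f by (rule eventually_compose_filterlim[rotated])
  then have "\<forall>\<^sub>F s in nhds 0. deriv (\<lambda>t. f (x + s *\<^sub>R a + t *\<^sub>R b)) 0 = N (x + s *\<^sub>R a) \<bullet> b"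
    by eventually_elim (rule inner)
  then have "second_dir_deriv f x a b = deriv (\<lambda>s. N (x + s *\<^sub>R a) \<bullet> b) 0"
    unfolding second_dir_deriv_def by (intro deriv_cong_ev refl)
  also have "\<dots> = H a \<bullet> b"
  proof (rule DERIV_imp_deriv)
    have N0: "(N has_derivative H) (at (x + 0 *\<^sub>R a))" using N by simp
    from has_derivative_compose[OF line N0]
    have "((\<lambda>s. N (x + s *\<^sub>R a) \<bullet> b) has_derivative (\<lambda>s. H (s *\<^sub>R a) \<bullet> b)) (at 0)"
      by (rule has_derivative_inner_left)
    then show "((\<lambda>s. N (x + s *\<^sub>R a) \<bullet> b) has_real_derivative H a \<bullet> b) (at 0)"
      by (simp add: has_field_derivative_def H.scaleR mult.commute[of _ "H a \<bullet> b"])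
  qed
  finally show ?thesis .
qed

text \<open>
  A self-adjoint derivative of the gradient field is the operator that represents the second directional
  derivatives, and such an operator is unique.
\<close>

lemma hessian_eq:
  fixes f :: "'a::euclidean_space \<Rightarrow> real"
  assumes f: "\<forall>\<^sub>F y in nhds x. (f has_derivative (\<lambda>a. N y \<bullet> a)) (at y)"
    and N: "(N has_derivative H) (at x)"
    and sym: "\<And>a b. H a \<bullet> b = a \<bullet> H b"
  shows "hessian f x = H"
  unfolding hessian_def
proof (rule the_equality)
  show "linear H \<and> (\<forall>a b. H a \<bullet> b = a \<bullet> H b) \<and> (\<forall>a b. H a \<bullet> b = second_dir_deriv f x a b)"
    using second_dir_deriv_eq[OF f N] sym bounded_linear.linear[OF has_derivative_bounded_linear[OF N]]
    by simp
  fix K assume K: "linear K \<and> (\<forall>a b. K a \<bullet> b = a \<bullet> K b) \<and> (\<forall>a b. K a \<bullet> b = second_dir_deriv f x a b)"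
  have "\<forall>b. K a \<bullet> b = H a \<bullet> b" for a using K second_dir_deriv_eq[OF f N, of a] by metis
  then show "K = H" unfolding vector_eq_rdot by blast
qed

lemma gradient_eq:
  fixes f :: "'a::euclidean_space \<Rightarrow> real"
  assumes "(f has_derivative (\<lambda>a. g \<bullet> a)) (at x)"
  shows "gradient f x = g"
  unfolding gradient_def
proof (rule the_equality)
  show "(f has_derivative (\<lambda>a. g \<bullet> a)) (at x)" by (rule assms)
  fix g' assume "(f has_derivative (\<lambda>a. g' \<bullet> a)) (at x)"
  then have "(\<lambda>a. g' \<bullet> a) = (\<lambda>a. g \<bullet> a)" using assms by (rule has_derivative_unique)
  then have "\<forall>a. g' \<bullet> a = g \<bullet> a" by metis
  then show "g' = g" unfolding vector_eq_rdot .
qed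

text \<open>
  Adding the tangent inequalities at \<open>x\<close> and \<open>y\<close>.
\<close>

lemma convex_on_deriv_mono:
  fixes h :: "real \<Rightarrow> real"
  assumes cv: "convex_on {0<..} h"
    and d: "\<And>x. x > 0 \<Longrightarrow> (h has_real_derivative h' x) (at x)"
    and x: "0 < x" and xy: "x \<le> y"
  shows "h' x \<le> h' y"
proof (cases "x = y")
  case False
  have t: "h t - h s \<ge> h' s * (t - s)" if "s > 0" "t > 0" for s t
    using that d[of s] by (intro convex_on_imp_above_tangent[OF cv]) (auto intro: has_field_derivative_at_within simp: interior_open)
  have "(h' y - h' x) * (y - x) \<ge> 0"
    using t[of x y] t[of y x] x xy by (simp add: algebra_simps)
  then show ?thesis using False xy by (simp add: zero_le_mult_iff)
qed simp

lemma positive_regular_scale: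
  fixes w :: "'a::euclidean_jordan_algebra"
  assumes "w \<in> positive_regular" "t > 0"
  shows "t *\<^sub>R w \<in> positive_regular"
proof -
  obtain d ev c where s: "spectral_decomp d w ev c" "inj_on ev {1..d}" "\<forall>i\<in>{1..d}. ev i > 0"
    using assms by (auto simp: positive_regular_def)
  then have "spectral_decomp d (t *\<^sub>R w) (\<lambda>i. t * ev i) c"
    by (simp add: spectral_decomp_def scaleR_sum_right)
  moreover have "inj_on (\<lambda>i. t * ev i) {1..d}" 
  proof (rule inj_onI)
    fix i j assume "i \<in> {1..d}" "j \<in> {1..d}" "t * ev i = t * ev j"
    then show "i = j" using inj_onD[OF s(2)] assms(2) by simp
  qed
  moreover have "\<forall>i\<in>{1..d}. t * ev i > 0" using s(3) assms(2) by simp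
  ultimately show ?thesis unfolding positive_regular_def by blast
qed

lemma spectral_fun_gradient:
  fixes x :: "'a::euclidean_jordan_algebra"
  assumes h: "\<And>t. t > 0 \<Longrightarrow> (h has_real_derivative h' t) (at t)" and x: "x \<in> positive_regular"
  shows "(spectral_fun h has_derivative (\<lambda>a. jfun h' x \<bullet> a)) (at x)"
proof -
  obtain d ev c where s: "spectral_decomp d x ev c" and inj: "inj_on ev {1..d}"
    and pos: "\<forall>i\<in>{1..d}. ev i > 0" using x by (auto simp: positive_regular_def)
  show ?thesis unfolding jfun_distinct[OF s inj]
    using h pos by (intro spectral_fun_has_derivative[OF s inj]) auto
qed

text \<open>
  The point \<open>\<mu> = v\<^sup>-\<^sup>1 w\<close> and the slack \<open>\<zeta>\<close> as functions of \<open>(u, v, w)\<close>.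
\<close>

definition slice :: "real \<times> real \<times> 'a::euclidean_jordan_algebra \<Rightarrow> 'a" where
  "slice X = inverse (fst (snd X)) *\<^sub>R snd (snd X)"

definition gap :: "(real \<Rightarrow> real) \<Rightarrow> real \<times> real \<times> 'a::euclidean_jordan_algebra \<Rightarrow> real" where
  "gap h X = fst X - fst (snd X) * spectral_fun h (slice X)"

definition barrier_gradient ::
  "(real \<Rightarrow> real) \<Rightarrow> real \<times> real \<times> 'a::euclidean_jordan_algebra \<Rightarrow> real \<times> real \<times> 'a" where
  "barrier_gradient h X =
    (- inverse (gap h X),
     (spectral_fun h (slice X) - jfun (deriv h) (slice X) \<bullet> slice X) * inverse (gap h X) - inverse (fst (snd X)),
     inverse (gap h X) *\<^sub>R jfun (deriv h) (slice X) - jinv (snd (snd X)))"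

lemma Gamma_barrier_eq:
  "Gamma_barrier h X = - ln (gap h X) - ln (fst (snd X)) - ln (jdet (snd (snd X)))"
  by (simp add: Gamma_barrier_def gap_def slice_def case_prod_unfold)

lemma fst_has_derivative [derivative_intros]: "(fst has_derivative fst) F"
  by (rule bounded_linear_imp_has_derivative[OF bounded_linear_fst])

lemma snd_has_derivative [derivative_intros]: "(snd has_derivative snd) F"
  by (rule bounded_linear_imp_has_derivative[OF bounded_linear_snd])

lemma slice_has_derivative:
  assumes v: "fst (snd X) \<noteq> 0"
  shows "(slice has_derivative
     (\<lambda>A. inverse (fst (snd X)) *\<^sub>R (snd (snd A) - fst (snd A) *\<^sub>R slice X))) (at X)"
proof -
  have v': "((\<lambda>X. fst (snd X)) has_derivative (\<lambda>A. fst (snd A))) (at X)"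
    and w': "((\<lambda>X. snd (snd X)) has_derivative (\<lambda>A. snd (snd A))) (at X)"
    by (auto intro!: derivative_eq_intros)
  have "((\<lambda>X. inverse (fst (snd X))) has_derivative
      (\<lambda>A. - (inverse (fst (snd X)) * fst (snd A) * inverse (fst (snd X))))) (at X)"
    by (rule Deriv.has_derivative_inverse[OF v v'])
  from has_derivative_scaleR[OF this w'] show ?thesis
    unfolding slice_def[abs_def] by (simp add: algebra_simps)
qed

lemma gap_has_derivative:
  assumes v: "fst (snd X) \<noteq> 0" and g: "(spectral_fun h has_derivative (\<lambda>a. g \<bullet> a)) (at (slice X))"
  shows "(gap h has_derivative
     (\<lambda>A. fst A - (spectral_fun h (slice X) - g \<bullet> slice X) * fst (snd A) - g \<bullet> snd (snd A))) (at X)"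
proof -
  have u': "(fst has_derivative fst) (at X)"
    and v': "((\<lambda>X. fst (snd X)) has_derivative (\<lambda>A. fst (snd A))) (at X)"
    by (auto intro!: derivative_eq_intros)
  have "((\<lambda>X. spectral_fun h (slice X)) has_derivative
     (\<lambda>A. g \<bullet> (inverse (fst (snd X)) *\<^sub>R (snd (snd A) - fst (snd A) *\<^sub>R slice X)))) (at X)"
    by (rule has_derivative_compose[OF slice_has_derivative[OF v] g])
  note d = has_derivative_diff[OF u' has_derivative_mult[OF v' this]]
  have cancel: "fst (snd X) * (inverse (fst (snd X)) * t) = t" for t using v by simp
  show ?thesis
    unfolding gap_def[abs_def]
    by (rule has_derivative_eq_rhs[OF d], rule ext) (simp add: inner_diff_right cancel, simp add: algebra_simps)
qed

lemma barrier_has_gradient: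
  fixes X :: "real \<times> real \<times> 'a::euclidean_jordan_algebra"
  assumes h: "\<And>t. t > 0 \<Longrightarrow> (h has_real_derivative deriv h t) (at t)"
    and v: "fst (snd X) > 0" and w: "snd (snd X) \<in> positive_regular" and gap: "gap h X > 0"
  shows "(Gamma_barrier h has_derivative (\<lambda>A. barrier_gradient h X \<bullet> A)) (at X)"
proof -
  have s: "slice X \<in> positive_regular" unfolding slice_def using v w by (simp add: positive_regular_scale)
  have v': "((\<lambda>X. fst (snd X)) has_derivative (\<lambda>A. fst (snd A))) (at X)"
    and w': "((\<lambda>X. snd (snd X)) has_derivative (\<lambda>A. snd (snd A))) (at X)"
    by (auto intro!: derivative_eq_intros)
  let ?g = "jfun (deriv h) (slice X)"
  have gap': "(gap h has_derivative
     (\<lambda>A. fst A - (spectral_fun h (slice X) - ?g \<bullet> slice X) * fst (snd A) - ?g \<bullet> snd (snd A))) (at X)"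
    using v by (intro gap_has_derivative spectral_fun_gradient h s) auto
  note d = has_derivative_diff[OF has_derivative_diff[OF
      has_derivative_minus[OF has_derivative_ln[OF gap gap']]
      has_derivative_ln[OF v v']] has_derivative_compose[OF w' ln_jdet_has_derivative[OF w]]]
  show ?thesis
    unfolding Gamma_barrier_eq[abs_def]
    by (rule has_derivative_eq_rhs[OF d], rule ext)
      (auto simp: barrier_gradient_def inner_prod_def divide_inverse inner_diff_left algebra_simps)
qed

text \<open>
  Here \<open>Dg\<close> is the derivative of \<open>\<nabla>\<phi>\<close> at \<open>\<mu>\<close>, \<open>W\<close> the negated derivative of the inverse at \<open>w\<close>, and
  \<open>z\<close> is the derivative of the slack \<open>\<zeta>\<close>.
\<close>

definition barrier_hessian ::
  "('a \<Rightarrow> 'a) \<Rightarrow> ('a \<Rightarrow> 'a) \<Rightarrow> real \<Rightarrow> real \<Rightarrow> real \<Rightarrow> 'a \<Rightarrow> 'a \<Rightarrow>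
    real \<times> real \<times> 'a \<Rightarrow> real \<times> real \<times> 'a::euclidean_jordan_algebra" where
  "barrier_hessian Dg W v \<zeta> \<sigma> g \<mu> A =
    (let z = fst A - \<sigma> * fst (snd A) - g \<bullet> snd (snd A);
         G = Dg (inverse v *\<^sub>R (snd (snd A) - fst (snd A) *\<^sub>R \<mu>))
     in (inverse (\<zeta>\<^sup>2) * z,
         - inverse \<zeta> * (G \<bullet> \<mu>) - inverse (\<zeta>\<^sup>2) * \<sigma> * z + inverse (v\<^sup>2) * fst (snd A),
         inverse \<zeta> *\<^sub>R G - (inverse (\<zeta>\<^sup>2) * z) *\<^sub>R g + W (snd (snd A))))"

lemma barrier_gradient_has_derivative:
  fixes X :: "real \<times> real \<times> 'a::euclidean_jordan_algebra"
  assumes v: "fst (snd X) \<noteq> 0" and gap: "gap h X \<noteq> 0"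
    and g: "(spectral_fun h has_derivative (\<lambda>a. jfun (deriv h) (slice X) \<bullet> a)) (at (slice X))"
    and Dg: "(jfun (deriv h) has_derivative Dg) (at (slice X))"
    and W: "(jinv has_derivative (\<lambda>a. - W a)) (at (snd (snd X)))"
  shows "(barrier_gradient h has_derivative
    barrier_hessian Dg W (fst (snd X)) (gap h X)
      (spectral_fun h (slice X) - jfun (deriv h) (slice X) \<bullet> slice X) (jfun (deriv h) (slice X)) (slice X)) (at X)"
proof -
  let ?g = "jfun (deriv h) (slice X)" and ?\<mu> = "slice X" and ?v = "fst (snd X)" and ?\<zeta> = "gap h X"
  let ?\<sigma> = "spectral_fun h ?\<mu> - ?g \<bullet> ?\<mu>"
  define z where "z A = fst A - ?\<sigma> * fst (snd A) - ?g \<bullet> snd (snd A)" for A :: "real \<times> real \<times> 'a"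
  define m where "m A = inverse ?v *\<^sub>R (snd (snd A) - fst (snd A) *\<^sub>R ?\<mu>)" for A :: "real \<times> real \<times> 'a"
  have v': "((\<lambda>X. fst (snd X)) has_derivative (\<lambda>A. fst (snd A))) (at X)"
    and w': "((\<lambda>X. snd (snd X)) has_derivative (\<lambda>A. snd (snd A))) (at X)"
    by (auto intro!: derivative_eq_intros)
  have \<mu>': "(slice has_derivative m) (at X)" unfolding m_def[abs_def] by (rule slice_has_derivative[OF v])
  have gap': "(gap h has_derivative z) (at X)" unfolding z_def[abs_def] by (rule gap_has_derivative[OF v g])
  have i\<zeta>: "((\<lambda>X. inverse (gap h X)) has_derivative (\<lambda>A. - (inverse ?\<zeta> * z A * inverse ?\<zeta>))) (at X)"
    by (rule Deriv.has_derivative_inverse[OF gap gap'])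
  have iv: "((\<lambda>X. inverse (fst (snd X))) has_derivative (\<lambda>A. - (inverse ?v * fst (snd A) * inverse ?v))) (at X)"
    by (rule Deriv.has_derivative_inverse[OF v v'])
  have \<phi>': "((\<lambda>X. spectral_fun h (slice X)) has_derivative (\<lambda>A. ?g \<bullet> m A)) (at X)"
    by (rule has_derivative_compose[OF \<mu>' g])
  have g': "((\<lambda>X. jfun (deriv h) (slice X)) has_derivative (\<lambda>A. Dg (m A))) (at X)"
    by (rule has_derivative_compose[OF \<mu>' Dg])
  note d = has_derivative_Pair[OF has_derivative_minus[OF i\<zeta>] has_derivative_Pair[OF
     has_derivative_diff[OF has_derivative_mult[OF has_derivative_diff[OF \<phi>' has_derivative_inner[OF g' \<mu>']] i\<zeta>] iv]
     has_derivative_diff[OF has_derivative_scaleR[OF i\<zeta> g'] has_derivative_compose[OF w' W]]]]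
  have H: "barrier_hessian Dg W ?v ?\<zeta> ?\<sigma> ?g ?\<mu> A =
      (inverse (?\<zeta>\<^sup>2) * z A,
       - inverse ?\<zeta> * (Dg (m A) \<bullet> ?\<mu>) - inverse (?\<zeta>\<^sup>2) * ?\<sigma> * z A + inverse (?v\<^sup>2) * fst (snd A),
       inverse ?\<zeta> *\<^sub>R Dg (m A) - (inverse (?\<zeta>\<^sup>2) * z A) *\<^sub>R ?g + W (snd (snd A)))" for A
    by (simp only: barrier_hessian_def Let_def z_def m_def)
  show ?thesis
    unfolding barrier_gradient_def[abs_def]
    by (rule has_derivative_eq_rhs[OF d], rule ext)
      (simp add: H power2_eq_square algebra_simps)
qed

text \<open>
  With \<open>m A\<close> the derivative of the slice, the bilinear form is
  \<open>z A z B / \<zeta>\<^sup>2 + (v / \<zeta>) (Dg (m A) \<bullet> m B)\<close> plus two forms in \<open>v\<close> and \<open>w\<close> alone, each of them symmetric.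
\<close>

lemma barrier_hessian_selfadjoint:
  assumes "linear Dg" and Dg: "\<And>x y. Dg x \<bullet> y = x \<bullet> Dg y" and W: "\<And>x y. W x \<bullet> y = x \<bullet> W y"
    and v: "v \<noteq> 0"
  shows "barrier_hessian Dg W v \<zeta> \<sigma> g \<mu> A \<bullet> B = A \<bullet> barrier_hessian Dg W v \<zeta> \<sigma> g \<mu> B"
proof -
  define z where "z A = fst A - \<sigma> * fst (snd A) - g \<bullet> snd (snd A)" for A :: "real \<times> real \<times> 'a"
  define m where "m A = inverse v *\<^sub>R (snd (snd A) - fst (snd A) *\<^sub>R \<mu>)" for A :: "real \<times> real \<times> 'a"
  have expand: "barrier_hessian Dg W v \<zeta> \<sigma> g \<mu> A \<bullet> B = inverse (\<zeta>\<^sup>2) * (z A * z B)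
      + inverse \<zeta> * v * (Dg (m A) \<bullet> m B) + inverse (v\<^sup>2) * (fst (snd A) * fst (snd B))
      + W (snd (snd A)) \<bullet> snd (snd B)" for A B
  proof -
    have B: "snd (snd B) = v *\<^sub>R m B + fst (snd B) *\<^sub>R \<mu>"
      using v by (simp add: m_def)
    have "barrier_hessian Dg W v \<zeta> \<sigma> g \<mu> A \<bullet> B = inverse (\<zeta>\<^sup>2) * (z A * z B)
      + inverse \<zeta> * (Dg (m A) \<bullet> snd (snd B) - fst (snd B) * (Dg (m A) \<bullet> \<mu>))
      + inverse (v\<^sup>2) * (fst (snd A) * fst (snd B)) + W (snd (snd A)) \<bullet> snd (snd B)"
      unfolding barrier_hessian_def Let_def z_def[symmetric] m_def[symmetric] inner_prod_def
      by (simp add: inner_add_left inner_diff_left z_def[of B] algebra_simps)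
    also have "Dg (m A) \<bullet> snd (snd B) - fst (snd B) * (Dg (m A) \<bullet> \<mu>) = v * (Dg (m A) \<bullet> m B)"
      by (subst B) (simp add: inner_add_right)
    finally show ?thesis by simp
  qed
  have "barrier_hessian Dg W v \<zeta> \<sigma> g \<mu> A \<bullet> B = barrier_hessian Dg W v \<zeta> \<sigma> g \<mu> B \<bullet> A"
    unfolding expand using Dg[of "m A" "m B"] W[of "snd (snd A)" "snd (snd B)"]
    by (simp add: inner_commute mult.commute)
  then show ?thesis by (simp add: inner_commute)
qed

text \<open>
  Block elimination. The first row says that the slack derivative of the solution is \<open>\<zeta>\<^sup>2 p\<close>. The third
  row becomes \<open>M Hw = p g + Hv (M \<gamma>) + r\<close>, which is solved by \<open>Hw\<close>. In the second row the term
  \<open>W Hw \<bullet> w\<close> is \<open>Hw \<bullet> wi\<close>, and \<open>Minv wi = w - v \<gamma>\<close> turns everything into a scalar equation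
  for \<open>Hv\<close> with leading coefficient \<open>k3\<close>.
\<close>

lemma barrier_hessian_solution:
  fixes g \<mu> r \<alpha> \<gamma> w wi Hw :: "'a::euclidean_jordan_algebra"
  assumes v: "v \<noteq> 0" and \<zeta>: "\<zeta> \<noteq> 0"
    and linDg: "linear Dg" and linW: "linear W" and linM: "linear M"
    and W_sym: "\<And>x y. W x \<bullet> y = x \<bullet> W y" and Minv_sym: "\<And>x y. Minv x \<bullet> y = x \<bullet> Minv y"
    and M: "\<And>x. M x = inverse (\<zeta> * v) *\<^sub>R Dg x + W x"
    and MMinv: "\<And>x. M (Minv x) = x" and \<alpha>: "Minv g = \<alpha>"
    and M\<gamma>: "M \<gamma> = inverse (\<zeta> * v\<^sup>2) *\<^sub>R Dg w"
    and \<mu>: "\<mu> = inverse v *\<^sub>R w" and Ww: "W w = wi"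
    and \<gamma>: "Minv wi = w - v *\<^sub>R \<gamma>"
    and k1: "k1 = \<zeta>\<^sup>2 + g \<bullet> \<alpha>" and k2: "k2 = \<sigma> + g \<bullet> \<gamma>"
    and k3: "k3 = inverse (v\<^sup>2) + inverse v * (\<gamma> \<bullet> wi)" "k3 \<noteq> 0"
    and Hv: "Hv = inverse k3 * (k2 * p + q + \<gamma> \<bullet> r)"
    and Hu: "Hu = k1 * p + k2 * Hv + \<alpha> \<bullet> r"
    and Hw: "Hw = p *\<^sub>R \<alpha> + Hv *\<^sub>R \<gamma> + Minv r"
  shows "barrier_hessian Dg W v \<zeta> \<sigma> g \<mu> (Hu, Hv, Hw) = (p, q, r)"
proof -
  define G where "G = Dg (inverse v *\<^sub>R (Hw - Hv *\<^sub>R \<mu>))"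
  have Mr: "\<alpha> \<bullet> x = g \<bullet> Minv x" for x using Minv_sym[of g] by (simp add: \<alpha>)
  have z: "Hu - \<sigma> * Hv - g \<bullet> Hw = \<zeta>\<^sup>2 * p"
    unfolding Hu Hw k1 k2 by (simp add: inner_add_right Mr algebra_simps)
  have "M \<alpha> = g" using MMinv[of g] by (simp add: \<alpha>)
  then have MHw: "M Hw = p *\<^sub>R g + Hv *\<^sub>R (inverse (\<zeta> * v\<^sup>2) *\<^sub>R Dg w) + r"
    unfolding Hw by (simp only: linear_add[OF linM] linear_cmul[OF linM] M\<gamma> MMinv)
  have "inverse \<zeta> *\<^sub>R G = inverse (\<zeta> * v) *\<^sub>R Dg Hw - Hv *\<^sub>R (inverse (\<zeta> * v\<^sup>2) *\<^sub>R Dg w)"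
    unfolding G_def \<mu> using v \<zeta>
    by (simp add: linear_diff[OF linDg] linear_cmul[OF linDg] scaleR_diff_right power2_eq_square mult_ac)
  moreover have "inverse (\<zeta> * v) *\<^sub>R Dg Hw = M Hw - W Hw" using M[of Hw] by simp
  ultimately have G: "inverse \<zeta> *\<^sub>R G = p *\<^sub>R g + r - W Hw"
    unfolding MHw by simp
  have WHw: "W Hw \<bullet> w = p * (g \<bullet> w - v * (g \<bullet> \<gamma>)) + Hv * (\<gamma> \<bullet> wi) + (r \<bullet> w - v * (\<gamma> \<bullet> r))"
    unfolding W_sym Ww unfolding Hw
    by (simp add: inner_add_left Mr Minv_sym \<gamma> inner_diff_right inner_commute[of r])
  have "- inverse \<zeta> * (G \<bullet> \<mu>) = - ((inverse \<zeta> *\<^sub>R G) \<bullet> \<mu>)" by simp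
  also have "\<dots> = inverse v * (W Hw \<bullet> w - p * (g \<bullet> w) - r \<bullet> w)"
    unfolding G \<mu> by (simp add: inner_add_left inner_diff_left algebra_simps)
  also have "\<dots> = Hv * (inverse v * (\<gamma> \<bullet> wi)) - p * (g \<bullet> \<gamma>) - \<gamma> \<bullet> r"
    unfolding WHw using v by (simp add: field_simps)
  finally have "- inverse \<zeta> * (G \<bullet> \<mu>) - \<sigma> * p + inverse (v\<^sup>2) * Hv = k3 * Hv - k2 * p - \<gamma> \<bullet> r"
    unfolding k3(1) k2 by (simp add: algebra_simps)
  also have "k3 * Hv = k2 * p + q + \<gamma> \<bullet> r"
    unfolding Hv by (simp only: mult.assoc[symmetric] right_inverse[OF k3(2)] mult_1)
  also have "k2 * p + q + \<gamma> \<bullet> r - k2 * p - \<gamma> \<bullet> r = q" by simp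
  finally have second: "- inverse \<zeta> * (G \<bullet> \<mu>) - \<sigma> * p + inverse (v\<^sup>2) * Hv = q" .
  have cancel: "inverse (\<zeta>\<^sup>2) * (\<zeta>\<^sup>2 * p) = p" "inverse (\<zeta>\<^sup>2) * \<sigma> * (\<zeta>\<^sup>2 * p) = \<sigma> * p"
    using \<zeta> by (simp_all add: field_simps)
  show ?thesis
    unfolding barrier_hessian_def Let_def fst_conv snd_conv z G_def[symmetric] cancel second G by simp
qed

section \<open>The inverse Hessian\<close>

theorem mainTheorem4:
  fixes h :: "real \<Rightarrow> real"
    and d :: nat
    and u v p q \<zeta> \<sigma> k1 k2 k3 Hu Hv :: real
    and w r \<mu> grad \<alpha> \<gamma> Hw :: "'a::euclidean_jordan_algebra"
    and ev h1 h2 :: "nat \<Rightarrow> real"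
    and c :: "nat \<Rightarrow> 'a"
    and m :: "nat \<Rightarrow> nat \<Rightarrow> real"
    and Minv :: "'a \<Rightarrow> 'a"
  assumes rank: "d = jrank TYPE('a)"
    and h_convex: "convex_on {0<..} h"
    and h_smooth: "Ck_on 3 h {0<..}"
    and nonhomogeneous: "\<not> homogeneous_on_cone (spectral_fun h :: 'a \<Rightarrow> real)"
    and dom: "(u, v, w) \<in> dom_Gamma h"
    and spectral: "spectral_decomp d w ev c"
    and ev_distinct: "inj_on ev {1..d}"
    and ev_pos: "\<forall>i\<in>{1..d}. ev i > 0"
    and mu: "\<mu> = inverse v *\<^sub>R w"
    and zeta: "\<zeta> = u - v * spectral_fun h \<mu>"
    and h1: "h1 = (\<lambda>i. deriv h (inverse v * ev i))"
    and h2: "h2 = (\<lambda>i. deriv (deriv h) (inverse v * ev i))"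
    and grad: "grad = gradient (spectral_fun h) \<mu>"
    and sigma: "\<sigma> = spectral_fun h \<mu> - grad \<bullet> \<mu>"
    and m: "m = (\<lambda>i j. if i = j
              then inverse \<zeta> * inverse v * h2 i + inverse ((ev i)\<^sup>2)
              else inverse \<zeta> * ((h1 i - h1 j) / (ev i - ev j)) + inverse (ev i) * inverse (ev j))"
    and Minv: "Minv = (\<lambda>x.
              (\<Sum>(i, j)\<in>{(i, j). 1 \<le> i \<and> i < j \<and> j \<le> d}.
                 (4 * inverse (m i j)) *\<^sub>R jL (c i) (jL (c j) x))
              + (\<Sum>i=1..d. inverse (m i i) *\<^sub>R jP (c i) x))"
    and alpha: "\<alpha> = (\<Sum>i=1..d. (inverse (m i i) * h1 i) *\<^sub>R c i)"
    and gamma: "\<gamma> = (inverse (v\<^sup>2) * inverse \<zeta>) *\<^sub>R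
              (\<Sum>i=1..d. (inverse (m i i) * h2 i * ev i) *\<^sub>R c i)"
    and k1: "k1 = \<zeta>\<^sup>2 + grad \<bullet> \<alpha>"
    and k2: "k2 = \<sigma> + grad \<bullet> \<gamma>"
    and k3: "k3 = inverse (v\<^sup>2) + inverse v * (\<gamma> \<bullet> jinv w)"
    and Hv: "Hv = inverse k3 * (k2 * p + q + \<gamma> \<bullet> r)"
    and Hu: "Hu = k1 * p + k2 * Hv + \<alpha> \<bullet> r"
    and Hw: "Hw = p *\<^sub>R \<alpha> + Hv *\<^sub>R \<gamma> + Minv r"
  shows "grad = (\<Sum>i=1..d. h1 i *\<^sub>R c i) \<and>
    inv (hessian (Gamma_barrier h) (u, v, w)) (p, q, r) = (Hu, Hv, Hw)"
proof -
  have hd: "(h has_real_derivative deriv h t) (at t)"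
    and hdd: "(deriv h has_real_derivative deriv (deriv h) t) (at t)" if "t > 0" for t
  proof -
    have "((deriv ^^ j) h) differentiable (at t)" if "j < 3" for j
      using h_smooth that \<open>t > 0\<close> unfolding Ck_on_def by auto
    from this[of 0] this[of "Suc 0"] show "(h has_real_derivative deriv h t) (at t)"
      "(deriv h has_real_derivative deriv (deriv h) t) (at t)"
      unfolding DERIV_deriv_iff_real_differentiable by simp_all
  qed
  have v: "v > 0" and \<zeta>: "\<zeta> > 0" using dom by (auto simp: dom_Gamma_def zeta mu)
  have fc: "jordan_frame d c" and w: "w = (\<Sum>i=1..d. ev i *\<^sub>R c i)"
    using spectral by (auto simp: spectral_decomp_def)
  have wreg: "w \<in> positive_regular"
    using spectral ev_distinct ev_pos unfolding positive_regular_def by blast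
  have \<mu>reg: "\<mu> \<in> positive_regular" unfolding mu using wreg v by (simp add: positive_regular_scale)
  have s\<mu>: "spectral_decomp d \<mu> (\<lambda>i. inverse v * ev i) c"
    using fc by (simp add: spectral_decomp_def mu w scaleR_sum_right)
  have inj\<mu>: "inj_on (\<lambda>i. inverse v * ev i) {1..d}"
    using inj_onD[OF ev_distinct] v by (intro inj_onI) simp
  have \<mu>pos: "inverse v * ev i > 0" if "i \<in> {1..d}" for i using v ev_pos that by simp
  have g': "(spectral_fun h has_derivative (\<lambda>a. jfun (deriv h) \<mu> \<bullet> a)) (at \<mu>)"
    by (rule spectral_fun_gradient[OF hd \<mu>reg])
  have grad_jfun: "grad = jfun (deriv h) \<mu>" unfolding grad by (rule gradient_eq[OF g'])
  have grad_sum: "grad = (\<Sum>i=1..d. h1 i *\<^sub>R c i)"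
    unfolding grad_jfun jfun_distinct[OF s\<mu> inj\<mu>] h1 ..

  define X where "X = (u, v, w)"
  have X: "fst (snd X) = v" "snd (snd X) = w" "slice X = \<mu>" "gap h X = \<zeta>"
    by (simp_all add: X_def slice_def gap_def mu zeta)
  define Dg where "Dg = peirce_mult d c
    (\<lambda>i j. if i = j then h2 i else (h1 i - h1 j) / (inverse v * ev i - inverse v * ev j))"
  define W where "W = peirce_mult d c (\<lambda>i j. inverse (ev i) * inverse (ev j))"
  define M where "M = peirce_mult d c m"
  define H where "H = barrier_hessian Dg W v \<zeta> \<sigma> grad \<mu>"

  have Dg: "(jfun (deriv h) has_derivative Dg) (at \<mu>)"
    unfolding Dg_def h1 h2 using hdd \<mu>pos by (intro jfun_has_derivative[OF s\<mu> inj\<mu>]) auto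
  have W: "(jinv has_derivative (\<lambda>a. - W a)) (at w)"
  proof -
    have J1: "(jfun inverse has_derivative peirce_mult d c
        (\<lambda>i j. if i = j then - (inverse (ev i) ^ 2)
               else (inverse (ev i) - inverse (ev j)) / (ev i - ev j))) (at w)"
    proof (rule jfun_has_derivative[OF spectral ev_distinct])
      fix i assume "i \<in> {1..d}"
      then have "ev i \<noteq> 0" using ev_pos by force
      then show "(inverse has_real_derivative - (inverse (ev i) ^ 2)) (at (ev i))"
        by (auto intro!: derivative_eq_intros simp: power2_eq_square)
    qed
    have J2: "peirce_mult d c (\<lambda>i j. if i = j then - (inverse (ev i) ^ 2)
               else (inverse (ev i) - inverse (ev j)) / (ev i - ev j)) a = - W a" for a
    proof -
      have "- W a = peirce_mult d c (\<lambda>i j. -1 * (inverse (ev i) * inverse (ev j))) a"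
        unfolding W_def peirce_mult_scale[symmetric] by simp
      also have "\<dots> = peirce_mult d c (\<lambda>i j. if i = j then - (inverse (ev i) ^ 2)
               else (inverse (ev i) - inverse (ev j)) / (ev i - ev j)) a"
      proof (rule peirce_mult_cong)
        fix i j assume ij: "i \<in> {1..d}" "j \<in> {1..d}"
        then have "ev i > 0" "ev j > 0" using ev_pos by auto
        moreover have "i \<noteq> j \<Longrightarrow> ev i - ev j \<noteq> 0" using inj_onD[OF ev_distinct _ ij] by auto
        ultimately show "-1 * (inverse (ev i) * inverse (ev j)) = (if i = j then - (inverse (ev i) ^ 2)
               else (inverse (ev i) - inverse (ev j)) / (ev i - ev j))"
          by (auto simp: power2_eq_square divide_simps)
      qed
      finally show ?thesis by simp
    qed
    show ?thesis unfolding jinv_def by (rule has_derivative_eq_rhs[OF J1 ext[OF J2]])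
  qed
  have linDg: "linear Dg" and linW: "linear W" and linM: "linear M"
    unfolding Dg_def W_def M_def by (rule linear_peirce_mult)+
  have sym: "Dg x \<bullet> y = x \<bullet> Dg y" "W x \<bullet> y = x \<bullet> W y" for x y
    unfolding Dg_def W_def by (rule peirce_mult_selfadjoint[OF fc])+

  have "(barrier_gradient h has_derivative barrier_hessian Dg W (fst (snd X)) (gap h X)
      (spectral_fun h (slice X) - jfun (deriv h) (slice X) \<bullet> slice X) (jfun (deriv h) (slice X)) (slice X)) (at X)"
    using v \<zeta> g' Dg W by (intro barrier_gradient_has_derivative) (simp_all add: X)
  then have N: "(barrier_gradient h has_derivative H) (at X)"
    unfolding X H_def sigma grad_jfun .
  have near: "\<forall>\<^sub>F Y in nhds X. (Gamma_barrier h has_derivative (\<lambda>A. barrier_gradient h Y \<bullet> A)) (at Y)"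
  proof -
    have "((\<lambda>Y. fst (snd Y)) \<longlongrightarrow> v) (nhds X)" "((\<lambda>Y. snd (snd Y)) \<longlongrightarrow> w) (nhds X)"
      using X by (auto intro!: isCont_tendsto_nhds continuous_intros)
    moreover have "(gap h \<longlongrightarrow> \<zeta>) (nhds X)"
      using v g' by (intro isCont_tendsto_nhds has_derivative_continuous[OF gap_has_derivative]) (simp_all add: X)
    ultimately have "\<forall>\<^sub>F Y in nhds X. fst (snd Y) > 0" "\<forall>\<^sub>F Y in nhds X. gap h Y > 0"
      "\<forall>\<^sub>F Y in nhds X. snd (snd Y) \<in> positive_regular"
      using order_tendstoD(1) v \<zeta> eventually_compose_filterlim[OF positive_regular_nhds[OF wreg]] by blast+
    then show ?thesis by eventually_elim (rule barrier_has_gradient[OF hd])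
  qed
  have hess: "hessian (Gamma_barrier h) (u, v, w) = H"
    unfolding X_def[symmetric] using near N
    by (rule hessian_eq) (use v in \<open>auto simp: H_def intro!: barrier_hessian_selfadjoint linDg sym\<close>)

  have h1_mono: "h1 i \<le> h1 j" if "i \<in> {1..d}" "j \<in> {1..d}" "ev i \<le> ev j" for i j
    unfolding h1 using that v \<mu>pos[of i] by (intro convex_on_deriv_mono[OF h_convex hd]) auto
  have h2_nonneg: "h2 i \<ge> 0" if "i \<in> {1..d}" for i
    unfolding h2
  proof (rule mono_on_imp_deriv_nonneg)
    show "mono_on {0<..} (deriv h)"
      by (intro mono_onI convex_on_deriv_mono[OF h_convex hd]) auto
  qed (use hdd \<mu>pos[OF that] in \<open>auto simp: interior_open\<close>)
  have m_pos: "m i j > 0" if ij: "i \<in> {1..d}" "j \<in> {1..d}" for i j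
  proof -
    have e: "ev i > 0" "ev j > 0" using ev_pos ij by auto
    have "(h1 i - h1 j) / (ev i - ev j) \<ge> 0"
      using h1_mono[OF ij] h1_mono[OF ij(2,1)] by (cases "ev i \<le> ev j") (auto simp: divide_nonpos_nonpos)
    then have "inverse \<zeta> * ((h1 i - h1 j) / (ev i - ev j)) \<ge> 0"
      using \<zeta> by (intro mult_nonneg_nonneg) auto
    moreover have "inverse \<zeta> * inverse v * h2 i \<ge> 0"
      using \<zeta> v h2_nonneg[OF ij(1)] by (intro mult_nonneg_nonneg) auto
    ultimately show ?thesis using e unfolding m by (auto intro: add_nonneg_pos)
  qed
  have Minv_eq: "Minv = peirce_mult d c (\<lambda>i j. inverse (m i j))"
  proof
    fix x
    have "(\<Sum>(i, j)\<in>strict_pairs d. (4 * inverse (m i j)) *\<^sub>R jL (c i) (jL (c j) x)) =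
        (\<Sum>a\<in>strict_pairs d. inverse (m (fst a) (snd a)) *\<^sub>R peirce c a x)"
      by (intro sum.cong refl) (auto simp: peirce_def jL_def strict_pairs_def)
    then show "Minv x = peirce_mult d c (\<lambda>i j. inverse (m i j)) x"
      unfolding Minv peirce_mult_def sum_weak_pairs strict_pairs_def[symmetric]
      by (simp add: peirce_def add.commute)
  qed
  have MMinv: "M (Minv x) = x" for x
    unfolding M_def Minv_eq peirce_mult_compose[OF fc]
    by (rule peirce_mult_one[OF fc]) (use m_pos in \<open>fastforce\<close>)
  have M_eq: "M x = inverse (\<zeta> * v) *\<^sub>R Dg x + W x" for x
    unfolding M_def Dg_def W_def peirce_mult_scale peirce_mult_add
  proof (rule peirce_mult_cong)
    fix i j
    have *: "inverse v * ev i - inverse v * ev j = inverse v * (ev i - ev j)" by (simp add: algebra_simps)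
    show "m i j = inverse (\<zeta> * v) * (if i = j then h2 i else (h1 i - h1 j) / (inverse v * ev i - inverse v * ev j))
         + inverse (ev i) * inverse (ev j)"
      unfolding m * using v by (simp add: power2_eq_square divide_inverse)
  qed
  have Minv_g: "Minv grad = \<alpha>"
    unfolding Minv_eq grad_sum peirce_mult_frame[OF fc] alpha ..
  have Dg_w: "Dg w = (\<Sum>i=1..d. (h2 i * ev i) *\<^sub>R c i)"
    unfolding Dg_def w peirce_mult_frame[OF fc] by simp
  have gamma': "\<gamma> = Minv (inverse (\<zeta> * v\<^sup>2) *\<^sub>R Dg w)"
    unfolding Dg_w Minv_eq linear_cmul[OF linear_peirce_mult] peirce_mult_frame[OF fc] gamma
    by (simp add: mult_ac)
  have M_gamma: "M \<gamma> = inverse (\<zeta> * v\<^sup>2) *\<^sub>R Dg w" unfolding gamma' by (rule MMinv)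
  have jinv_w: "jinv w = (\<Sum>i=1..d. inverse (ev i) *\<^sub>R c i)"
    unfolding jinv_def by (rule jfun_distinct[OF spectral ev_distinct])
  have W_w: "W w = jinv w"
  proof -
    have "(\<Sum>i=1..d. (inverse (ev i) * inverse (ev i) * ev i) *\<^sub>R c i) = (\<Sum>i=1..d. inverse (ev i) *\<^sub>R c i)"
    proof (intro sum.cong refl)
      fix i assume "i \<in> {1..d}"
      from bspec[OF ev_pos this]
      show "(inverse (ev i) * inverse (ev i) * ev i) *\<^sub>R c i = inverse (ev i) *\<^sub>R c i" by simp
    qed
    then show ?thesis unfolding W_def jinv_w by (subst w, subst peirce_mult_frame[OF fc])
  qed
  have MinvM: "Minv (M x) = x" for x
    unfolding M_def Minv_eq peirce_mult_compose[OF fc]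
    by (rule peirce_mult_one[OF fc]) (use m_pos in \<open>fastforce\<close>)
  have Minv_jinv: "Minv (jinv w) = w - v *\<^sub>R \<gamma>"
  proof -
    have "jinv w = M w - v *\<^sub>R (inverse (\<zeta> * v\<^sup>2) *\<^sub>R Dg w)"
      unfolding M_eq W_w using v by (simp add: power2_eq_square)
    then have "jinv w = M (w - v *\<^sub>R \<gamma>)"
      by (simp only: linear_diff[OF linM] linear_cmul[OF linM] M_gamma)
    then show ?thesis using MinvM by simp
  qed
  have "\<gamma> \<bullet> jinv w \<ge> 0"
    unfolding gamma inner_scaleR_left inner_sum_left
  proof (intro mult_nonneg_nonneg sum_nonneg)
    fix i assume i: "i \<in> {1..d}"
    have "c i \<bullet> jinv w = inverse (ev i)"
      using spectral_coeff[of d "jinv w" "\<lambda>i. inverse (ev i)" c i] fc i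
      by (simp add: spectral_decomp_def jinv_w inner_commute)
    then show "0 \<le> c i \<bullet> jinv w" using bspec[OF ev_pos i] by simp
    show "0 \<le> inverse (m i i)" "0 \<le> h2 i" "0 \<le> ev i"
      using m_pos[OF i i] h2_nonneg[OF i] bspec[OF ev_pos i] by auto
  qed (use \<zeta> v in auto)
  then have "k3 > 0" unfolding k3 using v by (intro add_pos_nonneg) auto
  then have k3': "k3 \<noteq> 0" by simp
  have Minv_sym: "Minv x \<bullet> y = x \<bullet> Minv y" for x y
    unfolding Minv_eq by (rule peirce_mult_selfadjoint[OF fc])

  note solution = barrier_hessian_solution[OF _ _ linDg linW linM sym(2) Minv_sym M_eq MMinv Minv_g
      M_gamma mu W_w Minv_jinv k1 k2 k3 k3', folded H_def]
  have sol: "H (Hu, Hv, Hw) = (p, q, r)"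
    using v \<zeta> by (intro solution[OF _ _ Hv Hu Hw]) auto
  have "surj H"
  proof (rule surjI)
    fix y :: "real \<times> real \<times> 'a"
    show "H ((\<lambda>y. let Hv' = inverse k3 * (k2 * fst y + fst (snd y) + \<gamma> \<bullet> snd (snd y)) in
        (k1 * fst y + k2 * Hv' + \<alpha> \<bullet> snd (snd y), Hv', fst y *\<^sub>R \<alpha> + Hv' *\<^sub>R \<gamma> + Minv (snd (snd y)))) y) = y"
      using v \<zeta> solution[OF _ _ refl refl refl, of "fst y" "fst (snd y)" "snd (snd y)"] by (simp add: Let_def)
  qed
  moreover have "linear H" using N by (intro bounded_linear.linear has_derivative_bounded_linear)
  ultimately have "inj H" by (intro linear_surjective_imp_injective) auto
  then show ?thesis using grad_sum sol unfolding hess by (simp add: inv_f_eq)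
qed

end
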